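(* Let $\Omega\subset\mathbb{R}^2$ be the interior of a simple polygon, let $\mathscr{T}$ be a triangulation of $\overline\Omega$ and let $\sigma\in PC_+(\mathscr{T})$. For any function $\beta:E_I\to\mathbb{R}$ on the set $E_I$ of interior edges, there exists a unique $\tilde\sigma=S_\beta(\sigma)\in PC(\mathscr{T})$ satisfying: (i) $\tilde\sigma$ is a constant matrix in the interior of each triangle of $\mathscr{T}$; (ii) if $e=\{x_j,x_k\}\in E_I$ with $j<k$, and $T,T'$ are the two triangles of $\mathscr{T}$ having both $x_j$ and $x_k$ as vertices, where $\partial T$ has the same orientation as the directed edge $(x_j,x_k)$ and $\partial T'$ the opposite one, then $$\int_T\tilde\sigma\nabla v_j\cdot\nabla v_k\,dx=\int_T\sigma\nabla v_j\cdot\nabla v_k\,dx+\beta(e),\qquad \int_{T'}\tilde\sigma\nabla v_j\cdot\nabla v_k\,dx=\int_{T'}\sigma\nabla v_j\cdot\nabla v_k\,dx-\beta(e);$$ (iii) if $e=\{x_j,x_k\}\in E_B$ and $T$ is the unique triangle having both $x_j$ and $x_k$ as vertices, then $\int_T\tilde\sigma\nabla v_j\cdot\nabla v_k\,dx=\int_T\sigma\nabla v_j\cdot\nabla v_k\,dx$. One also has (with the right-hand side well defined, i.e. $L(S_\beta(\sigma))$ invertible) $$\Lambda_\sigma^{\mathrm{FEM}(\mathscr{T})}=\Lambda_{S_\beta(\sigma)}^{\mathrm{FEM}(\mathscr{T})}.$$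
   Context: Triangulation: a finite set $\mathscr{T}$ of closed (nondegenerate) triangles in $\mathbb{R}^2$ with union $\overline\Omega$, such that two distinct triangles are either disjoint or meet in exactly one common vertex or one full common edge. $V=\{x_1,\dots,x_N\}$ is the set of all vertices, labeled so that $V_B=\{x_1,\dots,x_B\}=V\cap\partial\Omega$. $E$ is the set of unordered pairs $\{x_j,x_k\}$ that are sides of triangles of $\mathscr{T}$; $E_I$ (interior edges) consists of the edges belonging to exactly two triangles, $E_B$ (boundary edges) of those belonging to only one triangle. Triangles are oriented counterclockwise; "$\partial T$ has the same orientation as the directed edge $(x,y)$" means that the counterclockwise traversal of $\partial T$ goes along that side from $x$ to $y$. $PC(\mathscr{T})$ is the set of $\sigma\in L^\infty(\Omega;\mathbb{R}^{2\times2})$ that are equal to a constant symmetric matrix in the interior of each triangle; $PC_+(\mathscr{T})$ is the subset of those that are positive definite on each triangle. FEM model: $v_k:\overline\Omega\to\mathbb{R}$ is the continuous function, affine on each triangle, with $v_k(x_k)=1$ and $v_k(x_j)=0$ for $j\ne k$. $L(\sigma)=(l_{jk})_{j,k=1}^N$ has $l_{jk}=\delta_{jk}$ for $1\le j\le B$ and $l_{jk}=\int_\Omega\sigma\nabla v_j\cdot\nabla v_k\,dx$ for $B+1\le j\le N$. If $L(\sigma)$ is invertible (true for $\sigma\in PC_+(\mathscr{T})$), $\Lambda_\sigma^{\mathrm{FEM}(\mathscr{T})}:\mathbb{R}^B\to\mathbb{R}^B$ is $(\Lambda_\sigma^{\mathrm{FEM}(\mathscr{T})}f)_j=\sum_{k=1}^N\big(\int_\Omega\sigma\nabla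 v_j\cdot\nabla v_k\,dx\big)u_k$, $1\le j\le B$, where $L(\sigma)u=(f,0)^t$. *)

theory Defs
  imports "HOL-Analysis.Analysis" "Jordan_Normal_Form.Matrix"
begin

no_notation Matrix.scalar_prod (infix \<open>\<bullet>\<close> 70)
no_notation Matrix.vec_index (infixl \<open>$\<close> 100)
hide_const (open) Matrix.mat Matrix.vec

type_synonym plane = "real^2"

section \<open>Simple polygons\<close>

fun polygonal_path :: "plane list \<Rightarrow> real \<Rightarrow> plane" where
  "polygonal_path [] = linepath 0 0"
| "polygonal_path [a] = linepath a a"
| "polygonal_path [a, b] = linepath a b"
| "polygonal_path (a # b # c # ps) = linepath a b +++ polygonal_path (b # c # ps)"

definition simple_polygon_interior :: "plane set \<Rightarrow> bool" where
  "simple_polygon_interior \<Omega> \<longleftrightarrow>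
     (\<exists>ps. ps \<noteq> [] \<and> simple_path (polygonal_path (ps @ [hd ps])) \<and>
           \<Omega> = inside (path_image (polygonal_path (ps @ [hd ps]))))"

section \<open>Triangulations\<close>

definition vertices :: "plane set \<Rightarrow> plane set" where
  "vertices T = {p. p extreme_point_of T}"

definition triangulation_of :: "plane set set \<Rightarrow> plane set \<Rightarrow> bool" where
  "triangulation_of \<T> S \<longleftrightarrow> triangulation \<T> \<and> (\<forall>T\<in>\<T>. 2 simplex T) \<and> \<Union>\<T> = S"

text \<open>The library notion \<^const>\<open>triangulation\<close> asks that the intersection of any two members be
  a common face. For nondegenerate triangles this is the usual condition on disjointness,
  common vertices and common edges.\<close>

lemma triangle_hull:
  assumes "2 simplex T"
  shows "finite (vertices T)" "card (vertices T) = 3" "\<not> affine_dependent (vertices T)"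
    "T = convex hull vertices T"
proof -
  from assms obtain C where C: "\<not> affine_dependent C" "int (card C) = 2 + 1" "T = convex hull C"
    unfolding simplex_def by blast
  then have v: "vertices T = C"
    by (auto simp: vertices_def extreme_point_of_convex_hull_affine_independent)
  show "finite (vertices T)" "card (vertices T) = 3" "\<not> affine_dependent (vertices T)"
    "T = convex hull vertices T"
    using C v aff_independent_finite by auto
qed

lemma triangle_face_iff:
  assumes "2 simplex T"
  shows "F face_of T \<longleftrightarrow> (\<exists>c\<subseteq>vertices T. F = convex hull c)"
  using face_of_convex_hull_affine_independent[of "vertices T" F] triangle_hull[OF assms] by simp

lemma triangulation_of_iff:
  "triangulation_of \<T> S \<longleftrightarrow>
     finite \<T> \<and> (\<forall>T\<in>\<T>. 2 simplex T) \<and> \<Union>\<T> = S \<and>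
     (\<forall>T\<in>\<T>. \<forall>T'\<in>\<T>. T \<noteq> T' \<longrightarrow>
        T \<inter> T' = {} \<or>
        (\<exists>p \<in> vertices T \<inter> vertices T'. T \<inter> T' = {p}) \<or>
        (\<exists>p q. p \<noteq> q \<and> {p, q} \<subseteq> vertices T \<inter> vertices T' \<and> T \<inter> T' = closed_segment p q))"
    (is "?L \<longleftrightarrow> ?R")
proof
  assume L: ?L
  then have fin: "finite \<T>" and s2: "\<And>T. T \<in> \<T> \<Longrightarrow> 2 simplex T" and U: "\<Union>\<T> = S"
    and face: "\<And>T T'. T \<in> \<T> \<Longrightarrow> T' \<in> \<T> \<Longrightarrow> (T \<inter> T') face_of T"
    by (auto simp: triangulation_of_def triangulation_def)
  have "T \<inter> T' = {} \<or> (\<exists>p \<in> vertices T \<inter> vertices T'. T \<inter> T' = {p}) \<or>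
        (\<exists>p q. p \<noteq> q \<and> {p, q} \<subseteq> vertices T \<inter> vertices T' \<and> T \<inter> T' = closed_segment p q)"
    if T: "T \<in> \<T>" and T': "T' \<in> \<T>" and ne: "T \<noteq> T'" for T T'
  proof -
    obtain c where c: "c \<subseteq> vertices T" "T \<inter> T' = convex hull c"
      using face[OF T T'] triangle_face_iff[OF s2[OF T]] by blast
    obtain d where d: "d \<subseteq> vertices T'" "T \<inter> T' = convex hull d"
      using face[OF T' T] triangle_face_iff[OF s2[OF T']] by (auto simp: Int_commute)
    have ic: "\<not> affine_dependent c" and id: "\<not> affine_dependent d"
      using c(1) d(1) triangle_hull(3)[OF s2[OF T]] triangle_hull(3)[OF s2[OF T']]
        affine_dependent_subset by blast+
    have "c = {p. p extreme_point_of (T \<inter> T')}"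
      unfolding c(2) using ic by (auto simp: extreme_point_of_convex_hull_affine_independent)
    moreover have "d = {p. p extreme_point_of (T \<inter> T')}"
      unfolding d(2) using id by (auto simp: extreme_point_of_convex_hull_affine_independent)
    ultimately have cd: "c = d" by simp
    have finc: "finite c" using c(1) triangle_hull(1)[OF s2[OF T]] finite_subset by blast
    have le: "card c \<le> 3"
      using card_mono[OF triangle_hull(1)[OF s2[OF T]] c(1)] triangle_hull(2)[OF s2[OF T]] by simp
    have "card c \<noteq> 3"
    proof
      assume "card c = 3"
      then have "c = vertices T" "d = vertices T'"
        using card_subset_eq[OF triangle_hull(1)[OF s2[OF T]] c(1)] triangle_hull(2)[OF s2[OF T]]
          card_subset_eq[OF triangle_hull(1)[OF s2[OF T']] d(1)] triangle_hull(2)[OF s2[OF T']] cd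
        by simp_all
      with cd ne triangle_hull(4)[OF s2[OF T]] triangle_hull(4)[OF s2[OF T']] show False by simp
    qed
    then consider "card c = 0" | "card c = 1" | "card c = 2" using le by linarith
    then show ?thesis
    proof cases
      case 1 then show ?thesis using finc c(2) by simp
    next
      case 2
      then obtain p where "c = {p}" by (auto simp: card_1_singleton_iff)
      then show ?thesis using c d cd by auto
    next
      case 3
      then obtain p q where "c = {p, q}" "p \<noteq> q" by (auto simp: card_2_iff)
      then show ?thesis using c d cd by (auto simp: segment_convex_hull)
    qed
  qed
  with fin s2 U show ?R by (intro conjI ballI impI)
next
  assume R: ?R
  from R have fin: "finite \<T>" by (elim conjE)
  from R have "\<forall>T\<in>\<T>. 2 simplex T" by (elim conjE)
  then have s2: "\<And>T. T \<in> \<T> \<Longrightarrow> 2 simplex T" by (rule bspec)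
  from R have U: "\<Union>\<T> = S" by (elim conjE)
  from R have meet: "\<forall>T\<in>\<T>. \<forall>T'\<in>\<T>. T \<noteq> T' \<longrightarrow> T \<inter> T' = {} \<or> (\<exists>p \<in> vertices T \<inter> vertices T'. T \<inter> T' = {p}) \<or>
        (\<exists>p q. p \<noteq> q \<and> {p, q} \<subseteq> vertices T \<inter> vertices T' \<and> T \<inter> T' = closed_segment p q)"
    by (elim conjE)
  have "(T \<inter> T') face_of T" if T: "T \<in> \<T>" and T': "T' \<in> \<T>" for T T'
  proof (cases "T = T'")
    case True
    have "convex T" using s2[OF T] convex_simplex by auto
    with True show ?thesis by (simp add: face_of_refl)
  next
    case False
    then have "T \<inter> T' = {} \<or>
        (\<exists>p \<in> vertices T \<inter> vertices T'. T \<inter> T' = {p}) \<or>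
        (\<exists>p q. p \<noteq> q \<and> {p, q} \<subseteq> vertices T \<inter> vertices T' \<and> T \<inter> T' = closed_segment p q)"
      using meet[rule_format, OF T T'] by simp
    then have "\<exists>c\<subseteq>vertices T. T \<inter> T' = convex hull c"
    proof (elim disjE bexE exE conjE)
      assume "T \<inter> T' = {}" then show ?thesis by (intro exI[of _ "{}"]) simp
    next
      fix p assume "p \<in> vertices T \<inter> vertices T'" "T \<inter> T' = {p}"
      then show ?thesis by (intro exI[of _ "{p}"]) simp
    next
      fix p q assume "{p, q} \<subseteq> vertices T \<inter> vertices T'" "T \<inter> T' = closed_segment p q"
      then show ?thesis by (intro exI[of _ "{p, q}"]) (simp add: segment_convex_hull)
    qed
    then show ?thesis by (simp only: triangle_face_iff[OF s2[OF T]])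
  qed
  moreover have "\<forall>T\<in>\<T>. \<exists>n. n simplex T" using s2 by auto
  ultimately show ?L unfolding triangulation_of_def triangulation_def using fin s2 U by simp
qed

text \<open>Labels start at 0, as do the matrix indices of \<^typ>\<open>real mat\<close>: the points
  \<open>x\<^sub>1, \<dots>, x\<^sub>N\<close> are \<open>x 0, \<dots>, x (N - 1)\<close>, and the boundary vertices are \<open>x 0, \<dots>, x (B - 1)\<close>.\<close>

definition vertex_labeling ::
    "plane set \<Rightarrow> plane set set \<Rightarrow> nat \<Rightarrow> nat \<Rightarrow> (nat \<Rightarrow> plane) \<Rightarrow> bool" where
  "vertex_labeling \<Omega> \<T> N B x \<longleftrightarrow>
     B \<le> N \<and> bij_betw x {..<N} (\<Union>T\<in>\<T>. vertices T) \<and>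
     x ` {..<B} = (\<Union>T\<in>\<T>. vertices T) \<inter> frontier \<Omega>"

definition triangles_at :: "plane set set \<Rightarrow> plane set \<Rightarrow> plane set set" where
  "triangles_at \<T> e = {T\<in>\<T>. e \<subseteq> vertices T}"

definition edges :: "plane set set \<Rightarrow> plane set set" where
  "edges \<T> = {{p, q} | p q. p \<noteq> q \<and> (\<exists>T\<in>\<T>. {p, q} \<subseteq> vertices T)}"

definition interior_edges :: "plane set set \<Rightarrow> plane set set" where
  "interior_edges \<T> = {e\<in>edges \<T>. card (triangles_at \<T> e) = 2}"

definition boundary_edges :: "plane set set \<Rightarrow> plane set set" where
  "boundary_edges \<T> = {e\<in>edges \<T>. card (triangles_at \<T> e) = 1}"

text \<open>The triangle with vertices \<open>p, q, r\<close> is traversed counterclockwise in this order iff the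
  determinant with rows \<open>q - p\<close> and \<open>r - p\<close> is positive.\<close>

definition ccw_side :: "plane set \<Rightarrow> plane \<Rightarrow> plane \<Rightarrow> bool" where
  "ccw_side T p q \<longleftrightarrow>
     (\<exists>r. vertices T = {p, q, r} \<and> Determinants.det (vector [q - p, r - p] :: real^2^2) > 0)"

section \<open>Piecewise constant conductivities\<close>

text \<open>Elements of \<open>L\<^sup>\<infinity>(\<Omega>)\<close> are represented by functions; two functions represent the same element
  iff they agree almost everywhere on \<open>\<Omega>\<close>, so all pointwise conditions are almost everywhere
  conditions.\<close>

definition Linfty :: "plane set \<Rightarrow> (plane \<Rightarrow> real^2^2) set" where
  "Linfty \<Omega> = {\<sigma>. \<sigma> \<in> borel_measurable (lebesgue_on \<Omega>) \<and>
     (\<exists>C. AE y in lebesgue_on \<Omega>. norm (\<sigma> y) \<le> C)}"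

definition pos_def :: "real^2^2 \<Rightarrow> bool" where
  "pos_def A \<longleftrightarrow> (\<forall>w. w \<noteq> 0 \<longrightarrow> w \<bullet> (A *v w) > 0)"

definition PC :: "plane set \<Rightarrow> plane set set \<Rightarrow> (plane \<Rightarrow> real^2^2) set" where
  "PC \<Omega> \<T> = {\<sigma>\<in>Linfty \<Omega>. \<forall>T\<in>\<T>. \<exists>A. transpose A = A \<and>
     (AE y in lebesgue_on (interior T). \<sigma> y = A)}"

definition PC_plus :: "plane set \<Rightarrow> plane set set \<Rightarrow> (plane \<Rightarrow> real^2^2) set" where
  "PC_plus \<Omega> \<T> = {\<sigma>\<in>PC \<Omega> \<T>. \<forall>T\<in>\<T>. \<exists>A. transpose A = A \<and> pos_def A \<and>
     (AE y in lebesgue_on (interior T). \<sigma> y = A)}"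

section \<open>The finite element model\<close>

text \<open>Outside \<open>\<Union>\<T>\<close> the function \<open>v\<^sub>k\<close> is fixed to \<^const>\<open>undefined\<close> (via \<^const>\<open>extensional\<close>), so that
  the description determines it uniquely.\<close>

definition hat :: "plane set set \<Rightarrow> nat \<Rightarrow> (nat \<Rightarrow> plane) \<Rightarrow> nat \<Rightarrow> plane \<Rightarrow> real" where
  "hat \<T> N x k = (THE v. v \<in> extensional (\<Union>\<T>) \<and> continuous_on (\<Union>\<T>) v \<and>
     (\<forall>T\<in>\<T>. \<exists>a b. \<forall>y\<in>T. v y = a \<bullet> y + b) \<and>
     (\<forall>j<N. v (x j) = (if j = k then 1 else 0)))"

text \<open>The gradient of \<open>v\<^sub>k\<close> exists in the interior of every triangle, hence almost everywhere in \<open>\<Omega>\<close>.\<close>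

definition grad :: "(plane \<Rightarrow> real) \<Rightarrow> plane \<Rightarrow> plane" where
  "grad f y = (THE D. GDERIV f y :> D)"

definition energy ::
    "plane set set \<Rightarrow> nat \<Rightarrow> (nat \<Rightarrow> plane) \<Rightarrow> plane set \<Rightarrow> (plane \<Rightarrow> real^2^2) \<Rightarrow> nat \<Rightarrow> nat \<Rightarrow> real" where
  "energy \<T> N x D \<sigma> j k =
     (LINT y|lebesgue_on D. (\<sigma> y *v grad (hat \<T> N x j) y) \<bullet> grad (hat \<T> N x k) y)"

definition FEM_matrix ::
    "plane set \<Rightarrow> plane set set \<Rightarrow> nat \<Rightarrow> nat \<Rightarrow> (nat \<Rightarrow> plane) \<Rightarrow> (plane \<Rightarrow> real^2^2) \<Rightarrow> real mat" where
  "FEM_matrix \<Omega> \<T> N B x \<sigma> = Matrix.mat N N (\<lambda>(j, k).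
     if j < B then (if j = k then 1 else 0) else energy \<T> N x \<Omega> \<sigma> j k)"

text \<open>Meaningful only if the matrix \<open>L(\<sigma>)\<close>, i.e. \<^const>\<open>FEM_matrix\<close>, is invertible.\<close>

definition FEM_DN ::
    "plane set \<Rightarrow> plane set set \<Rightarrow> nat \<Rightarrow> nat \<Rightarrow> (nat \<Rightarrow> plane) \<Rightarrow> (plane \<Rightarrow> real^2^2)
      \<Rightarrow> real Matrix.vec \<Rightarrow> real Matrix.vec" where
  "FEM_DN \<Omega> \<T> N B x \<sigma> f =
     (let u = (THE u. u \<in> carrier_vec N \<and>
                 FEM_matrix \<Omega> \<T> N B x \<sigma> *\<^sub>v u = f @\<^sub>v 0\<^sub>v (N - B))
      in Matrix.vec B (\<lambda>j. \<Sum>k<N. energy \<T> N x \<Omega> \<sigma> j k * vec_index u k))"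

section \<open>The conditions defining \<open>S\<^sub>\<beta>(\<sigma>)\<close>\<close>

definition edge_shift ::
    "plane set set \<Rightarrow> nat \<Rightarrow> (nat \<Rightarrow> plane) \<Rightarrow> (plane set \<Rightarrow> real)
      \<Rightarrow> (plane \<Rightarrow> real^2^2) \<Rightarrow> (plane \<Rightarrow> real^2^2) \<Rightarrow> bool" where
  "edge_shift \<T> N x \<beta> \<sigma> \<sigma>' \<longleftrightarrow>
     (\<forall>T\<in>\<T>. \<exists>A. AE y in lebesgue_on (interior T). \<sigma>' y = A) \<and>
     (\<forall>j k T T'. j < k \<and> k < N \<and> {x j, x k} \<in> interior_edges \<T> \<and>
        triangles_at \<T> {x j, x k} = {T, T'} \<and> ccw_side T (x j) (x k) \<and> ccw_side T' (x k) (x j) \<longrightarrow>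
        energy \<T> N x T \<sigma>' j k = energy \<T> N x T \<sigma> j k + \<beta> {x j, x k} \<and>
        energy \<T> N x T' \<sigma>' j k = energy \<T> N x T' \<sigma> j k - \<beta> {x j, x k}) \<and>
     (\<forall>j k T. j < N \<and> k < N \<and> {x j, x k} \<in> boundary_edges \<T> \<and>
        triangles_at \<T> {x j, x k} = {T} \<longrightarrow>
        energy \<T> N x T \<sigma>' j k = energy \<T> N x T \<sigma> j k)"

end

theory Submission
  imports Defs "Jordan_Normal_Form.Determinant"
begin

text \<open>On a triangle \<open>T\<close> the gradients of the hat functions are the gradients of the barycentric
  coordinates; they add up to \<open>0\<close> and are dual to the sides. Hence a symmetric matrix \<open>A\<close> is
  determined by the three numbers \<open>A \<nabla>v\<^sub>j \<bullet> \<nabla>v\<^sub>k\<close> for \<open>j \<noteq> k\<close>, and these can be prescribed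
  arbitrarily. Two triangles on the same side of a common edge would overlap, so an interior edge has
  one triangle of each orientation, and the conditions on the edges prescribe exactly these
  three numbers on each triangle: this gives existence and uniqueness. In the global stiffness matrix
  the two shifts \<open>\<plusminus>\<beta>(e)\<close> cancel, and the diagonal entries follow because all rows sum to \<open>0\<close>; so
  \<open>L(\<sigma>)\<close> and the Dirichlet-to-Neumann map are unchanged.

  For the invertibility of \<open>L(\<sigma>)\<close>, a kernel vector has zero energy, hence is constant on the vertices of
  each triangle. If it were nonzero somewhere, let \<open>K\<close> be the union of the triangles on which it
  is nonzero: an extreme point of the convex hull of \<open>K\<close> is a vertex that lies on the
  boundary of \<open>\<Omega>\<close>, where the vector vanishes.\<close>

no_notation Matrix.scalar_prod (infix \<open>\<bullet>\<close> 70)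
no_notation Matrix.vec_index (infixl \<open>$\<close> 100)
hide_const (open) Matrix.mat Matrix.vec

section \<open>Triangles in the plane\<close>

definition cross2 :: "plane \<Rightarrow> plane \<Rightarrow> real" where
  "cross2 u v = u $ 1 * v $ 2 - u $ 2 * v $ 1"

lemma det_vector_cross2: "Determinants.det (vector [u, v] :: real^2^2) = cross2 u v"
  by (simp add: Determinants.det_2 cross2_def)

lemma cross2_self [simp]: "cross2 u u = 0"
  and cross2_0_left [simp]: "cross2 0 u = 0"
  and cross2_0_right [simp]: "cross2 u 0 = 0"
  by (simp_all add: cross2_def)

lemma cross2_swap: "cross2 (p - q) (r - q) = - cross2 (q - p) (r - p)"
  by (simp add: cross2_def algebra_simps)

lemma inner_plane: "(u::plane) \<bullet> v = u $ 1 * v $ 1 + u $ 2 * v $ 2"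
  by (simp add: inner_vec_def sum_2)

lemma plane_eq_iff: "(u::plane) = v \<longleftrightarrow> u $ 1 = v $ 1 \<and> u $ 2 = v $ 2"
  by (simp add: Finite_Cartesian_Product.vec_eq_iff forall_2)

lemma plane_basis_eq:
  assumes "cross2 u v \<noteq> 0"
  shows "\<exists>a. a \<bullet> u = s \<and> a \<bullet> v = t"
proof -
  let ?D = "cross2 u v"
  \<comment> \<open>Cramer's rule for the two equations \<open>a \<bullet> u = s\<close> and
    \<open>a \<bullet> v = t\<close>.\<close>
  let ?a = "vector [(s * v $ 2 - t * u $ 2) / ?D, (t * u $ 1 - s * v $ 1) / ?D] :: plane"
  have "?a \<bullet> u = s" "?a \<bullet> v = t"
    using assms by (simp_all add: inner_plane divide_simps) (simp_all add: cross2_def algebra_simps)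
  then show ?thesis by blast
qed

lemma plane_basis_0:
  assumes "cross2 u v \<noteq> 0" "a \<bullet> u = 0" "a \<bullet> v = 0"
  shows "a = 0"
proof -
  have "a $ 1 * cross2 u v = (a \<bullet> u) * v $ 2 - (a \<bullet> v) * u $ 2"
    "a $ 2 * cross2 u v = (a \<bullet> v) * u $ 1 - (a \<bullet> u) * v $ 1"
    by (simp_all add: inner_plane cross2_def algebra_simps)
  with assms show ?thesis by (auto simp: plane_eq_iff)
qed

lemma cross2_eq_0_imp_collinear:
  assumes "cross2 (q - p) (r - p) = 0"
  shows "collinear {p, q, r}"
proof (cases "q = p")
  case False
  define u where "u = q - p"
  define v where "v = r - p"
  have u: "u \<noteq> 0" using False by (simp add: u_def)
  have c: "u $ 1 * v $ 2 = u $ 2 * v $ 1" using assms by (simp add: u_def v_def cross2_def)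
  have uu: "u \<bullet> u \<noteq> 0" using u by simp
  \<comment> \<open>The difference of the two sides is \<open>cross2 u v\<close> times
    \<open>u\<close> turned by a right angle, hence 0; dividing by \<open>u \<bullet> u\<close>
    displays \<open>v\<close> as a multiple of \<open>u\<close>.\<close>
  have "(u \<bullet> u) *\<^sub>R v = (u \<bullet> v) *\<^sub>R u"
    unfolding plane_eq_iff inner_plane using c by (simp add: algebra_simps) algebra
  then have "v = ((u \<bullet> v) / (u \<bullet> u)) *\<^sub>R u"
    using uu by (metis (no_types, lifting) divide_inverse_commute real_vector.scale_left_imp_eq
        real_vector.scale_scale scaleR_one right_inverse mult.commute)
  then have "collinear {0, u, v}" by (auto simp: collinear_lemma)
  then have "collinear {q, p, r}"
    using collinear_3[of q p r] by (simp add: u_def v_def NO_MATCH_def)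
  then show ?thesis by (simp add: insert_commute)
qed simp

lemma triangle_obtain:
  assumes "2 simplex T" "p \<in> vertices T" "q \<in> vertices T" "p \<noteq> q"
  obtains r where "vertices T = {p, q, r}" "cross2 (q - p) (r - p) \<noteq> 0"
    "T = convex hull {p, q, r}"
proof -
  note T = triangle_hull[OF assms(1)]
  have "card (vertices T - {p, q}) = 1"
    using T assms by (subst card_Diff_subset) auto
  then obtain r where r: "vertices T - {p, q} = {r}" by (auto simp: card_1_singleton_iff)
  then have v: "vertices T = {p, q, r}" using assms by auto
  have "cross2 (q - p) (r - p) \<noteq> 0"
  proof
    assume "cross2 (q - p) (r - p) = 0"
    then have "collinear {p, q, r}" by (rule cross2_eq_0_imp_collinear)
    moreover have "r \<noteq> p" "r \<noteq> q" using r by auto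
    ultimately show False using T(3) assms(4) v by (auto simp: collinear_3_eq_affine_dependent)
  qed
  with v T(4) show ?thesis by (intro that[of r]) auto
qed

lemma triangle_ex:
  assumes "2 simplex T"
  obtains p q r where "vertices T = {p, q, r}" "cross2 (q - p) (r - p) \<noteq> 0"
    "T = convex hull {p, q, r}" "p \<noteq> q"
proof -
  have "\<exists>p q. p \<in> vertices T \<and> q \<in> vertices T \<and> p \<noteq> q"
    using triangle_hull(2)[OF assms] card_le_Suc0_iff_eq[OF triangle_hull(1)[OF assms]] by auto
  then obtain p q where "p \<in> vertices T" "q \<in> vertices T" "p \<noteq> q" by blast
  then show ?thesis using triangle_obtain[OF assms] that by metis
qed

lemma vertex_in_triangle: "v \<in> vertices T \<Longrightarrow> v \<in> T"
  by (simp add: vertices_def extreme_point_of_def)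

lemma interior_triangle_nonempty:
  assumes "2 simplex (T::plane set)" shows "interior T \<noteq> {}"
  using interior_convex_hull_eq_empty[of "vertices T"] triangle_hull[OF assms] by simp

lemma convex_triangle: "2 simplex (T::plane set) \<Longrightarrow> convex T"
  and compact_triangle: "2 simplex (T::plane set) \<Longrightarrow> compact T"
  by (simp_all add: convex_simplex compact_simplex)

text \<open>The points where two affine functions agree form the solution set of one linear
  equation, which is convex. This carries agreement at vertices over to triangles and to their
  common faces.\<close>

lemma affine_eq_on_hull:
  fixes a a' :: "'a::real_inner"
  assumes "\<And>v. v \<in> c \<Longrightarrow> a \<bullet> v + b = a' \<bullet> v + b'" "y \<in> convex hull c"
  shows "a \<bullet> y + b = a' \<bullet> y + b'"
proof -
  have "convex hull c \<subseteq> {y. (a - a') \<bullet> y = b' - b}"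
    using assms(1) by (intro hull_minimal convex_hyperplane) (auto simp: algebra_simps)
  then show ?thesis using assms(2) by (auto simp: algebra_simps)
qed

lemma affine_interpolation:
  assumes "2 simplex T"
  shows "\<exists>a b. \<forall>v\<in>vertices T. a \<bullet> v + b = f v"
proof -
  obtain p q r where v: "vertices T = {p, q, r}" "cross2 (q - p) (r - p) \<noteq> 0"
    using triangle_ex[OF assms] .
  obtain a where "a \<bullet> (q - p) = f q - f p" "a \<bullet> (r - p) = f r - f p"
    using plane_basis_eq[OF v(2)] by blast
  then have "\<forall>v\<in>vertices T. a \<bullet> v + (f p - a \<bullet> p) = f v" by (simp add: v inner_diff_right)
  then show ?thesis by blast
qed

text \<open>The sides of a nondegenerate triangle span the plane. The vector identities for
  barycentric gradients below are proved by testing them against the sides.\<close>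

lemma triangle_normal_0:
  assumes "2 simplex T" "\<And>u v. u \<in> vertices T \<Longrightarrow> v \<in> vertices T \<Longrightarrow> a \<bullet> (v - u) = 0"
  shows "a = 0"
proof -
  obtain p q r where v: "vertices T = {p, q, r}" "cross2 (q - p) (r - p) \<noteq> 0"
    using triangle_ex[OF assms(1)] .
  then show ?thesis using assms(2) by (intro plane_basis_0[OF v(2)]) auto
qed

section \<open>Barycentric gradients and symmetric matrices\<close>

definition bary_grad :: "plane set \<Rightarrow> plane \<Rightarrow> plane" where
  "bary_grad T p = (SOME a. \<exists>b. \<forall>v\<in>vertices T. a \<bullet> v + b = (if v = p then 1 else 0))"

lemma bary_grad_affine:
  assumes "2 simplex T"
  obtains b where "\<And>v. v \<in> vertices T \<Longrightarrow> bary_grad T p \<bullet> v + b = (if v = p then 1 else 0)"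
  using someI_ex[OF affine_interpolation[OF assms, of "\<lambda>v. if v = p then 1 else 0"]] that
  unfolding bary_grad_def by blast

lemma bary_grad_inner:
  assumes "2 simplex T" "u \<in> vertices T" "v \<in> vertices T"
  shows "bary_grad T p \<bullet> (v - u) = (if v = p then 1 else 0) - (if u = p then 1 else 0)"
proof -
  obtain b where b: "\<And>v. v \<in> vertices T \<Longrightarrow> bary_grad T p \<bullet> v + b = (if v = p then 1 else 0)"
    using bary_grad_affine[OF assms(1)] by blast
  show ?thesis using b[OF assms(2)] b[OF assms(3)] by (simp add: inner_diff_right)
qed

lemma bary_grad_0:
  assumes "2 simplex T" "p \<notin> vertices T"
  shows "bary_grad T p = 0"
  using assms bary_grad_inner[OF assms(1)] by (intro triangle_normal_0[OF assms(1)]) auto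

text \<open>Barycentric coordinates add up to the constant 1, whose gradient vanishes.\<close>

lemma sum_bary_grad:
  assumes "2 simplex T"
  shows "(\<Sum>p\<in>vertices T. bary_grad T p) = 0"
proof (rule triangle_normal_0[OF assms])
  fix u v assume uv: "u \<in> vertices T" "v \<in> vertices T"
  have "(\<Sum>p\<in>vertices T. bary_grad T p) \<bullet> (v - u)
      = (\<Sum>p\<in>vertices T. (if v = p then 1 else 0) - (if u = p then 1 else 0))"
    unfolding inner_sum_left using bary_grad_inner[OF assms uv] by (intro sum.cong) auto
  also have "\<dots> = 0" using uv triangle_hull(1)[OF assms] by (simp add: sum_subtractf sum.delta)
  finally show "(\<Sum>p\<in>vertices T. bary_grad T p) \<bullet> (v - u) = 0" .
qed

text \<open>\<open>w\<close> is the gradient of the affine function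
  \<open>w \<bullet> (y - p)\<close> of \<open>y\<close>, which is recovered from its vertex values.
  In particular the barycentric gradients span the plane.\<close>

lemma bary_grad_expand:
  assumes "2 simplex T" "p \<in> vertices T"
  shows "w = (\<Sum>v\<in>vertices T. (w \<bullet> (v - p)) *\<^sub>R bary_grad T v)"
proof -
  have "w - (\<Sum>v\<in>vertices T. (w \<bullet> (v - p)) *\<^sub>R bary_grad T v) = 0"
  proof (rule triangle_normal_0[OF assms(1)])
    fix u v assume uv: "u \<in> vertices T" "v \<in> vertices T"
    have "(\<Sum>z\<in>vertices T. (w \<bullet> (z - p)) *\<^sub>R bary_grad T z) \<bullet> (v - u)
      = (\<Sum>z\<in>vertices T. (if z = v then w \<bullet> (z - p) else 0) - (if z = u then w \<bullet> (z - p) else 0))"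
      unfolding inner_sum_left using bary_grad_inner[OF assms(1) uv] by (intro sum.cong) auto
    also have "\<dots> = w \<bullet> (v - u)"
      using uv triangle_hull(1)[OF assms(1)] by (simp add: sum_subtractf inner_diff_right)
    finally show "(w - (\<Sum>z\<in>vertices T. (w \<bullet> (z - p)) *\<^sub>R bary_grad T z)) \<bullet> (v - u) = 0"
      by (simp add: inner_diff_left)
  qed
  then show ?thesis by simp
qed

lemma symmetric_matrix_inner:
  fixes A :: "real^'n^'n"
  assumes "transpose A = A" shows "(A *v u) \<bullet> w = (A *v w) \<bullet> u"
  by (metis assms dot_lmul_matrix inner_commute transpose_matrix_vector)

text \<open>For the difference \<open>M\<close> the diagonal values vanish with the others because
  the gradients add up to 0. As the gradients span the plane, \<open>M\<close> is 0.\<close>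

lemma symmetric_matrix_bary_eq:
  assumes T: "2 simplex T" and sym: "transpose A = A" "transpose A' = A'"
    and off: "\<And>u v. u \<in> vertices T \<Longrightarrow> v \<in> vertices T \<Longrightarrow> u \<noteq> v \<Longrightarrow>
      (A *v bary_grad T u) \<bullet> bary_grad T v = (A' *v bary_grad T u) \<bullet> bary_grad T v"
  shows "A = A'"
proof -
  let ?V = "vertices T"
  define M where "M = A - A'"
  note fin = triangle_hull(1)[OF T]
  have off0: "(M *v bary_grad T u) \<bullet> bary_grad T v = 0" if "u \<in> ?V" "v \<in> ?V" "u \<noteq> v" for u v
    using off[OF that] by (simp add: M_def matrix_vector_mult_diff_rdistrib inner_diff_left)
  have diag0: "(M *v bary_grad T u) \<bullet> bary_grad T u = 0" if u: "u \<in> ?V" for u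
  proof -
    have "0 = (M *v bary_grad T u) \<bullet> (\<Sum>v\<in>?V. bary_grad T v)" by (simp add: sum_bary_grad[OF T])
    also have "\<dots> = (\<Sum>v\<in>?V. (M *v bary_grad T u) \<bullet> bary_grad T v)" by (rule inner_sum_right)
    also have "\<dots> = (M *v bary_grad T u) \<bullet> bary_grad T u"
      unfolding sum.remove[OF fin u] using off0[OF u]
      by (auto intro!: sum.neutral)
    finally show ?thesis by simp
  qed
  obtain p where p: "p \<in> ?V" using triangle_hull(2)[OF T] by fastforce
  have "M *v bary_grad T u = 0" if "u \<in> ?V" for u
  proof -
    have "(M *v bary_grad T u) \<bullet> bary_grad T v = 0" if "v \<in> ?V" for v
      using off0 diag0 that \<open>u \<in> ?V\<close> by (cases "u = v") auto
    then have "(M *v bary_grad T u) \<bullet> w = 0" for w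
      by (subst bary_grad_expand[OF T p, of w]) (simp add: inner_sum_right)
    then show ?thesis by (metis inner_eq_zero_iff)
  qed
  then have "M *v w = 0" for w
    by (subst bary_grad_expand[OF T p, of w]) (simp add: linear_sum[OF matrix_vector_mul_linear] matrix_vector_mult_scaleR)
  then show ?thesis by (metis M_def matrix_eq matrix_vector_mult_0 eq_iff_diff_eq_0)
qed

definition outer_sq :: "plane \<Rightarrow> real^2^2" where
  "outer_sq u = (\<chi> i j. u $ i * u $ j)"

text \<open>The side \<open>q - p\<close> has inner product -1 with the gradient at
  \<open>p\<close>, 1 with that at \<open>q\<close> and 0 with the third. So the rank-one matrix
  \<open>outer_sq (q - p)\<close> contributes -1 to the pair \<open>p\<close>, \<open>q\<close> and
  nothing to the other pairs, and the three sides control the three values independently.\<close>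

lemma symmetric_matrix_bary_ex:
  assumes T: "2 simplex T" and c: "\<And>u v. c u v = c v u"
  obtains A where "transpose A = A" "\<And>u v. u \<in> vertices T \<Longrightarrow> v \<in> vertices T \<Longrightarrow> u \<noteq> v \<Longrightarrow>
      (A *v bary_grad T u) \<bullet> bary_grad T v = c u v"
proof -
  obtain p q r where V: "vertices T = {p, q, r}" and D: "cross2 (q - p) (r - p) \<noteq> 0"
    using triangle_ex[OF T] .
  then have ne: "p \<noteq> q" "p \<noteq> r" "q \<noteq> r" by auto
  define A where "A = - (c p q *\<^sub>R outer_sq (q - p) + c q r *\<^sub>R outer_sq (r - q) + c r p *\<^sub>R outer_sq (p - r))"
  have mult: "A *v w = - ((c p q * ((q - p) \<bullet> w)) *\<^sub>R (q - p) + (c q r * ((r - q) \<bullet> w)) *\<^sub>R (r - q)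
      + (c r p * ((p - r) \<bullet> w)) *\<^sub>R (p - r))" for w
    by (simp add: plane_eq_iff matrix_vector_mult_def inner_plane sum_2 A_def outer_sq_def algebra_simps)
  have "(A *v bary_grad T u) \<bullet> bary_grad T v = c u v"
    if "u \<in> vertices T" "v \<in> vertices T" "u \<noteq> v" for u v
  proof -
    note i = bary_grad_inner[OF T, unfolded V]
    have 1: "(q - p) \<bullet> bary_grad T w = (if q = w then 1 else 0) - (if p = w then 1 else 0)"
       "(r - q) \<bullet> bary_grad T w = (if r = w then 1 else 0) - (if q = w then 1 else 0)"
       "(p - r) \<bullet> bary_grad T w = (if p = w then 1 else 0) - (if r = w then 1 else 0)" for w
      using i[of p q w] i[of q r w] i[of r p w] by (simp_all add: inner_commute)
    show ?thesis
      unfolding mult inner_minus_left inner_add_left inner_scaleR_left 1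
      using that ne c unfolding V by auto
  qed
  moreover have "transpose A = A"
    by (simp add: Finite_Cartesian_Product.vec_eq_iff transpose_def A_def outer_sq_def algebra_simps)
  ultimately show ?thesis using that by blast
qed

section \<open>Integrals of piecewise constant functions\<close>

lemma negligible_closed_segment: "negligible (closed_segment a (b::plane))"
  by (simp add: negligible_convex_interior interior_closed_segment_ge2)

lemma pathstart_polygonal_path: "pathstart (polygonal_path (a # ps)) = a"
proof (cases ps)
  case (Cons b qs)
  then show ?thesis by (cases qs) simp_all
qed simp

lemma negligible_polygonal_path: "negligible (path_image (polygonal_path ps))"
proof (induction ps rule: polygonal_path.induct)
  case (4 a b c ps)
  have "path_image (polygonal_path (a # b # c # ps))
      = closed_segment a b \<union> path_image (polygonal_path (b # c # ps))"
    by (simp add: path_image_join pathstart_polygonal_path)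
  then show ?case using 4 negligible_closed_segment by (simp add: negligible_Un)
qed (simp_all add: negligible_closed_segment)

text \<open>The frontier of the inside of a closed set lies in that set, here a finite union of
  segments. These two properties are what the finite element argument takes from the
  polygon.\<close>

lemma simple_polygon_interior_props:
  assumes "simple_polygon_interior \<Omega>"
  shows "open \<Omega>" "negligible (frontier \<Omega>)"
proof -
  from assms obtain ps where
    p: "simple_path (polygonal_path ps)" "\<Omega> = inside (path_image (polygonal_path ps))"
    unfolding simple_polygon_interior_def by blast
  then have c: "closed (path_image (polygonal_path ps))"
    by (simp add: closed_path_image simple_path_imp_path)
  show "open \<Omega>" using c p by (simp add: open_inside)
  show "negligible (frontier \<Omega>)"
    using frontier_inside_subset[OF c] p negligible_polygonal_path negligible_subset by blast
qed

lemma AE_lebesgue_not_in: "negligible Z \<Longrightarrow> AE y in lebesgue. y \<notin> Z"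
  by (simp add: AE_not_in negligible_iff_null_sets)

text \<open>Integrability passes from \<open>g\<close> to \<open>f\<close> by completeness of
  Lebesgue measure, here through the spike rule for absolutely integrable functions. In this way the
  integrand of \<open>energy\<close>, which contains \<open>grad\<close>, gets its measurability
  from a comparison function.\<close>

lemma lebesgue_integral_eq_off_negligible:
  fixes f g :: "'a::euclidean_space \<Rightarrow> real"
  assumes "integrable lebesgue g" "AE y in lebesgue. f y = g y"
  shows "integral\<^sup>L lebesgue f = integral\<^sup>L lebesgue g"
proof -
  let ?Z = "{y. f y \<noteq> g y}"
  have Z: "negligible ?Z"
    using assms(2) by (simp add: completion.AE_iff_null_sets negligible_iff_null_sets)
  have g: "g absolutely_integrable_on UNIV"
    using assms(1) by (simp add: set_integrable_def)
  then have "f absolutely_integrable_on UNIV"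
    by (rule absolutely_integrable_spike[OF _ Z]) auto
  then have f: "integrable lebesgue f" by (simp add: set_integrable_def)
  have "integral\<^sup>L lebesgue f = integral UNIV f" using f by (rule integral_lebesgue[symmetric])
  also have "\<dots> = integral UNIV g" by (rule integral_spike[OF Z]) auto
  also have "\<dots> = integral\<^sup>L lebesgue g" using assms(1) by (rule integral_lebesgue)
  finally show ?thesis .
qed

text \<open>The pieces will be the interiors of triangles, which omit the sides; hence
  \<open>S\<close> and the union of the pieces are compared up to null sets.\<close>

lemma integral_piecewise_constant:
  fixes f :: "'a::euclidean_space \<Rightarrow> real"
  assumes fin: "finite \<P>" and S: "S \<in> sets lebesgue"
    and P: "\<And>P. P \<in> \<P> \<Longrightarrow> P \<in> lmeasurable" and disj: "disjoint \<P>"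
    and neg: "negligible (S - \<Union>\<P>)" "negligible (\<Union>\<P> - S)"
    and c: "\<And>P. P \<in> \<P> \<Longrightarrow> AE y in lebesgue_on P. f y = c P"
  shows "(LINT y|lebesgue_on S. f y) = (\<Sum>P\<in>\<P>. measure lebesgue P * c P)"
proof -
  \<comment> \<open>A simple function that agrees almost everywhere with \<open>f\<close> cut off to
    \<open>S\<close>, since the pieces are disjoint; it is integrated term by term.\<close>
  define g where "g y = (\<Sum>P\<in>\<P>. indicator P y * c P)" for y
  have int: "integrable lebesgue (\<lambda>y. indicator P y * c P)" if "P \<in> \<P>" for P
    using P[OF that] by (auto simp: fmeasurable_def intro!: integrable_real_indicator)
  have "AE y in lebesgue. y \<in> P \<longrightarrow> f y = c P" if "P \<in> \<P>" for P
    using c[OF that] P[OF that] by (simp add: AE_restrict_space_iff fmeasurableD)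
  then have 1: "AE y in lebesgue. \<forall>P\<in>\<P>. y \<in> P \<longrightarrow> f y = c P"
    using fin by (simp add: AE_ball_countable countable_finite)
  have "AE y in lebesgue. indicator S y *\<^sub>R f y = g y"
    using 1 AE_lebesgue_not_in[OF neg(1)] AE_lebesgue_not_in[OF neg(2)]
  proof eventually_elim
    case (elim y)
    show ?case
    proof (cases "y \<in> S")
      case True
      then obtain P where PP: "P \<in> \<P>" "y \<in> P" using elim by blast
      have "indicator Q y * c Q = (0::real)" if "Q \<in> \<P> - {P}" for Q
        using disj PP that by (auto simp: disjoint_def indicator_def)
      then have "g y = c P"
        unfolding g_def sum.remove[OF fin PP(1)] using PP by (simp add: sum.neutral)
      then show ?thesis using True elim PP by simp
    next
      case False
      then have "y \<notin> \<Union>\<P>" using elim by blast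
      then show ?thesis using False by (auto simp: g_def intro!: sum.neutral[symmetric])
    qed
  qed
  moreover have "integrable lebesgue g"
    unfolding g_def using int by (rule Bochner_Integration.integrable_sum)
  ultimately have "integral\<^sup>L lebesgue (\<lambda>y. indicator S y *\<^sub>R f y) = integral\<^sup>L lebesgue g"
    by (intro lebesgue_integral_eq_off_negligible)
  also have "\<dots> = (\<Sum>P\<in>\<P>. integral\<^sup>L lebesgue (\<lambda>y. indicator P y * c P))"
    unfolding g_def using int by (rule Bochner_Integration.integral_sum)
  also have "\<dots> = (\<Sum>P\<in>\<P>. measure lebesgue P * c P)"
    using P by (intro sum.cong) auto
  finally show ?thesis using S by (simp add: integral_restrict_space)
qed

lemma gradI:
  assumes "open U" "y \<in> U" "\<And>z. z \<in> U \<Longrightarrow> f z = a \<bullet> z + b"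
  shows "grad f y = a"
proof -
  have "((\<lambda>z. a \<bullet> z + b) has_derivative (\<bullet>) a) (at y)" by (auto intro!: derivative_eq_intros)
  then have "(f has_derivative (\<bullet>) a) (at y)"
    by (rule has_derivative_transform_within_open[OF _ assms(1,2)]) (simp add: assms(3))
  then have d: "GDERIV f y :> a"
    by (simp add: gderiv_def inner_commute[of _ a])
  \<comment> \<open>\<open>grad\<close> is a definite description, so uniqueness of the gradient has
    to be supplied as well.\<close>
  have "D = a" if "GDERIV f y :> D" for D
  proof -
    have "(\<lambda>h. h \<bullet> D) = (\<lambda>h. h \<bullet> a)"
      using that d has_derivative_unique unfolding gderiv_def by blast
    then have "(D - a) \<bullet> (D - a) = 0" by (metis inner_commute inner_diff_right right_minus_eq)
    then show ?thesis by simp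
  qed
  with d show ?thesis unfolding grad_def by blast
qed

section \<open>Hat functions\<close>

locale labeled_triangulation =
  fixes \<T> :: "plane set set" and N :: nat and x :: "nat \<Rightarrow> plane"
  assumes finite_triangles: "finite \<T>"
    and simplex: "T \<in> \<T> \<Longrightarrow> 2 simplex T"
    and face: "T \<in> \<T> \<Longrightarrow> T' \<in> \<T> \<Longrightarrow> (T \<inter> T') face_of T"
    and labels: "bij_betw x {..<N} (\<Union>T\<in>\<T>. vertices T)"
begin

lemma label_inj: "j < N \<Longrightarrow> k < N \<Longrightarrow> x j = x k \<longleftrightarrow> j = k"
  using labels by (auto simp: bij_betw_def inj_on_def)

lemma label_ex:
  assumes "T \<in> \<T>" "v \<in> vertices T"
  obtains j where "j < N" "v = x j"
  using assms labels by (force simp: bij_betw_def)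

lemma label_vertex:
  assumes "j < N"
  obtains T where "T \<in> \<T>" "x j \<in> vertices T"
  using assms labels by (force simp: bij_betw_def)

text \<open>The intersection is a face of both triangles, so it is spanned by vertices of each. Both
  spanning sets consist of the extreme points of the same set and therefore coincide.\<close>

lemma Int_eq_hull:
  assumes "T \<in> \<T>" "T' \<in> \<T>"
  obtains c where "c \<subseteq> vertices T" "c \<subseteq> vertices T'" "T \<inter> T' = convex hull c"
proof -
  obtain c where c: "c \<subseteq> vertices T" "T \<inter> T' = convex hull c"
    using face[OF assms] triangle_face_iff[OF simplex[OF assms(1)]] by blast
  obtain d where d: "d \<subseteq> vertices T'" "T \<inter> T' = convex hull d"
    using face[OF assms(2,1)] triangle_face_iff[OF simplex[OF assms(2)]] by (auto simp: Int_commute)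
  have "\<not> affine_dependent c" "\<not> affine_dependent d"
    using c d triangle_hull(3) simplex assms affine_dependent_subset by metis+
  then have "c = d"
    using c(2) d(2) by (metis (no_types, lifting) Collect_cong Collect_mem_eq
        extreme_point_of_convex_hull_affine_independent)
  with c d show ?thesis using that by blast
qed

definition hat_spec :: "nat \<Rightarrow> (plane \<Rightarrow> real) \<Rightarrow> bool" where
  "hat_spec k v \<longleftrightarrow> v \<in> extensional (\<Union>\<T>) \<and> continuous_on (\<Union>\<T>) v \<and>
     (\<forall>T\<in>\<T>. \<exists>a b. \<forall>y\<in>T. v y = a \<bullet> y + b) \<and>
     (\<forall>j<N. v (x j) = (if j = k then 1 else 0))"

lemma hat_spec_unique:
  assumes "hat_spec k v" "hat_spec k w"
  shows "v = w"
proof (rule extensionalityI)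
  show "v \<in> extensional (\<Union>\<T>)" "w \<in> extensional (\<Union>\<T>)"
    using assms by (simp_all add: hat_spec_def)
  fix y assume "y \<in> \<Union>\<T>"
  then obtain T where T: "T \<in> \<T>" "y \<in> T" by blast
  obtain a b where a: "\<And>z. z \<in> T \<Longrightarrow> v z = a \<bullet> z + b"
    using assms(1) T unfolding hat_spec_def by blast
  obtain a' b' where a': "\<And>z. z \<in> T \<Longrightarrow> w z = a' \<bullet> z + b'"
    using assms(2) T unfolding hat_spec_def by blast
  have "a \<bullet> z + b = a' \<bullet> z + b'" if "z \<in> vertices T" for z
  proof -
    obtain j where "j < N" "z = x j" using label_ex[OF T(1) \<open>z \<in> vertices T\<close>] .
    then have "v z = w z" using assms by (simp add: hat_spec_def)
    then show ?thesis using a a' that vertex_in_triangle by metis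
  qed
  moreover have "y \<in> convex hull (vertices T)" using T triangle_hull(4)[OF simplex] by metis
  ultimately have "a \<bullet> y + b = a' \<bullet> y + b'" by (rule affine_eq_on_hull)
  then show "v y = w y" using a a' T by simp
qed

lemma hat_spec_ex:
  assumes "k < N"
  shows "\<exists>v. hat_spec k v"
proof -
  define \<delta> where "\<delta> p = (if p = x k then 1 else 0 :: real)" for p
  have "\<forall>T\<in>\<T>. \<exists>a b. \<forall>v\<in>vertices T. a \<bullet> v + b = \<delta> v"
    using affine_interpolation[OF simplex] by blast
  then obtain a b where ab: "\<And>T v. T \<in> \<T> \<Longrightarrow> v \<in> vertices T \<Longrightarrow> a T \<bullet> v + b T = \<delta> v"
    by metis
  \<comment> \<open>A triangle through \<open>y\<close> is picked by choice; \<open>agree\<close>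
    shows that the value does not depend on it, because on a common face the two affine functions
    have the same vertex values.\<close>
  define v where "v y = (if y \<in> \<Union>\<T> then a (SOME T. T \<in> \<T> \<and> y \<in> T) \<bullet> y + b (SOME T. T \<in> \<T> \<and> y \<in> T)
      else undefined)" for y
  have agree: "a T \<bullet> y + b T = a T' \<bullet> y + b T'"
    if "T \<in> \<T>" "T' \<in> \<T>" "y \<in> T" "y \<in> T'" for T T' y
  proof -
    obtain c where c: "c \<subseteq> vertices T" "c \<subseteq> vertices T'" "T \<inter> T' = convex hull c"
      using Int_eq_hull[OF \<open>T \<in> \<T>\<close> \<open>T' \<in> \<T>\<close>] .
    show ?thesis
    proof (rule affine_eq_on_hull[of c])
      show "a T \<bullet> v + b T = a T' \<bullet> v + b T'" if "v \<in> c" for v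
        using ab[OF \<open>T \<in> \<T>\<close> subsetD[OF c(1) that]] ab[OF \<open>T' \<in> \<T>\<close> subsetD[OF c(2) that]] by simp
      show "y \<in> convex hull c" using c that by blast
    qed
  qed
  have v: "v y = a T \<bullet> y + b T" if "T \<in> \<T>" "y \<in> T" for T y
  proof -
    have "(SOME T. T \<in> \<T> \<and> y \<in> T) \<in> \<T> \<and> y \<in> (SOME T. T \<in> \<T> \<and> y \<in> T)"
      using that by (intro someI[of "\<lambda>T. T \<in> \<T> \<and> y \<in> T" T]) simp
    moreover have "y \<in> \<Union>\<T>" using that by blast
    ultimately show ?thesis using agree[OF _ that(1) _ that(2)] by (simp only: v_def if_True)
  qed
  have "hat_spec k v"
    unfolding hat_spec_def
  proof (intro conjI ballI allI impI)
    show "v \<in> extensional (\<Union>\<T>)" by (auto simp: v_def extensional_def)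
    show "continuous_on (\<Union>\<T>) v"
    proof -
      have "continuous_on (\<Union>T\<in>\<T>. id T) v"
      proof (rule continuous_on_closed_Union)
        fix T assume T: "T \<in> \<T>"
        show "closed (id T)" using compact_triangle[OF simplex[OF T]] compact_imp_closed by simp
        have "continuous_on T (\<lambda>y. a T \<bullet> y + b T)" by (intro continuous_intros)
        then show "continuous_on (id T) v"
          using v[OF T] by (simp cong: continuous_on_cong)
      qed (rule finite_triangles)
      then show ?thesis by simp
    qed
    show "\<exists>a b. \<forall>y\<in>T. v y = a \<bullet> y + b" if "T \<in> \<T>" for T using v[OF that] by blast
    fix j assume j: "j < N"
    obtain T where T: "T \<in> \<T>" "x j \<in> vertices T" using label_vertex[OF j] .
    then show "v (x j) = (if j = k then 1 else 0)"
      using v[OF T(1) vertex_in_triangle] ab[OF T] label_inj[OF j assms] by (simp add: \<delta>_def)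
  qed
  then show ?thesis by blast
qed

lemma hat_affine:
  assumes "k < N" "T \<in> \<T>"
  obtains b where "\<And>y. y \<in> T \<Longrightarrow> hat \<T> N x k y = bary_grad T (x k) \<bullet> y + b"
proof -
  have "hat \<T> N x k = (THE v. hat_spec k v)" by (simp only: hat_def hat_spec_def)
  moreover have "\<exists>!v. hat_spec k v" using hat_spec_ex[OF assms(1)] hat_spec_unique by blast
  ultimately have h: "hat_spec k (hat \<T> N x k)" by (simp add: theI')
  then obtain a b where ab: "\<And>y. y \<in> T \<Longrightarrow> hat \<T> N x k y = a \<bullet> y + b"
    using assms(2) unfolding hat_spec_def by blast
  note T = simplex[OF assms(2)]
  obtain b' where b': "\<And>v. v \<in> vertices T \<Longrightarrow> bary_grad T (x k) \<bullet> v + b' = (if v = x k then 1 else 0)"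
    using bary_grad_affine[OF T] by blast
  have "a \<bullet> v + b = bary_grad T (x k) \<bullet> v + b'" if v: "v \<in> vertices T" for v
  proof -
    obtain j where j: "j < N" "v = x j" using label_ex[OF assms(2) v] .
    have "a \<bullet> v + b = (if j = k then 1 else 0)"
      using h j ab[OF vertex_in_triangle[OF v]] by (simp add: hat_spec_def)
    then show ?thesis using b'[OF v] j label_inj[OF j(1) assms(1)] by simp
  qed
  then have "a \<bullet> y + b = bary_grad T (x k) \<bullet> y + b'" if "y \<in> convex hull (vertices T)" for y
    using that by (rule affine_eq_on_hull)
  then have "a \<bullet> y + b = bary_grad T (x k) \<bullet> y + b'" if "y \<in> T" for y
    using that triangle_hull(4)[OF T] by metis
  then show ?thesis using ab that by metis
qed

lemma grad_hat:
  assumes "k < N" "T \<in> \<T>" "y \<in> interior T"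
  shows "grad (hat \<T> N x k) y = bary_grad T (x k)"
proof -
  obtain b where "\<And>y. y \<in> T \<Longrightarrow> hat \<T> N x k y = bary_grad T (x k) \<bullet> y + b"
    using hat_affine[OF assms(1,2)] by blast
  then show ?thesis using assms(3) interior_subset by (intro gradI[of "interior T"]) auto
qed

text \<open>A proper face of a triangle misses its interior, and for distinct triangles the
  intersection is a proper face of at least one of them.\<close>

lemma interior_disjoint:
  assumes "T \<in> \<T>" "T' \<in> \<T>" "T \<noteq> T'"
  shows "interior T \<inter> interior T' = {}"
proof (cases "T \<inter> T' = T")
  case False
  then have "(T \<inter> T') \<inter> interior T = {}" using face_of_disjoint_interior[OF face[OF assms(1,2)]] by simp
  then show ?thesis using interior_subset by blast
next
  case True
  then have "T' \<inter> T \<noteq> T'" using assms(3) by blast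
  then have "(T' \<inter> T) \<inter> interior T' = {}" using face_of_disjoint_interior[OF face[OF assms(2,1)]] by simp
  then show ?thesis using interior_subset by blast
qed

lemma interior_inj: "inj_on interior \<T>"
  using interior_disjoint interior_triangle_nonempty[OF simplex] by (fastforce simp: inj_on_def)

lemma interior_lmeasurable: "T \<in> \<T> \<Longrightarrow> interior T \<in> lmeasurable"
  using compact_triangle[OF simplex] by (simp add: compact_imp_bounded lmeasurable_interior)

section \<open>Energies over unions of triangles\<close>

definition area :: "plane set \<Rightarrow> real" where
  "area T = measure lebesgue (interior T)"

lemma area_pos:
  assumes "T \<in> \<T>" shows "area T > 0"
proof -
  have "\<not> negligible (interior T)"
    using interior_triangle_nonempty[OF simplex[OF assms]] open_not_negligible by blast
  then show ?thesis
    using negligible_iff_measure[of "interior T"] interior_lmeasurable[OF assms]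
    by (simp add: area_def measure_le_0_iff not_le[symmetric])
qed

text \<open>Stated for a subfamily \<open>\<P>\<close> to cover both the single triangles of the
  edge conditions and the whole domain in \<open>FEM_matrix\<close>.\<close>

lemma energy_general:
  assumes "j < N" "k < N" "\<P> \<subseteq> \<T>" "S \<in> sets lebesgue"
    and neg: "negligible (S - \<Union>\<P>)" "negligible (\<Union>\<P> - S)"
    and A: "\<And>T. T \<in> \<P> \<Longrightarrow> AE y in lebesgue_on (interior T). \<sigma> y = A T"
  shows "energy \<T> N x S \<sigma> j k =
    (\<Sum>T\<in>\<P>. area T * ((A T *v bary_grad T (x j)) \<bullet> bary_grad T (x k)))"
proof -
  define Q where "Q T = (A T *v bary_grad T (x j)) \<bullet> bary_grad T (x k)" for T
  have fin: "finite \<P>" using assms(3) finite_triangles finite_subset by blast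
  have inj: "inj_on interior \<P>" using interior_inj assms(3) inj_on_subset by blast
  \<comment> \<open>The integral lemma indexes its pieces by the sets themselves, here interiors;
    inverting \<open>interior\<close> finds the triangle, and with it the matrix, that belongs to a
    piece.\<close>
  let ?i = "the_inv_into \<P> interior"
  have inv: "?i (interior T) = T" if "T \<in> \<P>" for T
    using the_inv_into_f_f[OF inj that] .
  have fr: "negligible (\<Union>T\<in>\<P>. frontier T)"
    using fin assms(3) convex_triangle[OF simplex] by (auto intro!: negligible_Union negligible_convex_frontier)
  have sub: "T \<subseteq> interior T \<union> frontier T" for T :: "plane set"
    using closure_subset by (auto simp: frontier_def)
  have "energy \<T> N x S \<sigma> j k = (\<Sum>P\<in>interior ` \<P>. measure lebesgue P * Q (?i P))"
    unfolding energy_def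
  proof (rule integral_piecewise_constant)
    show "finite (interior ` \<P>)" using fin by simp
    show "P \<in> lmeasurable" if "P \<in> interior ` \<P>" for P
      using that assms(3) interior_lmeasurable by auto
    show "disjoint (interior ` \<P>)"
      using interior_disjoint assms(3) by (force simp: disjoint_def)
    have "S - \<Union>(interior ` \<P>) \<subseteq> (S - \<Union>\<P>) \<union> (\<Union>T\<in>\<P>. frontier T)" using sub by blast
    then show "negligible (S - \<Union>(interior ` \<P>))"
      using neg(1) fr negligible_Un negligible_subset by metis
    have "\<Union>(interior ` \<P>) - S \<subseteq> \<Union>\<P> - S" using interior_subset by blast
    then show "negligible (\<Union>(interior ` \<P>) - S)" using neg(2) negligible_subset by blast
    fix P assume "P \<in> interior ` \<P>"
    then obtain T where T: "T \<in> \<P>" "P = interior T" by blast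
    have TT: "T \<in> \<T>" using T assms(3) by blast
    have "AE y in lebesgue_on (interior T).
      (\<sigma> y *v grad (hat \<T> N x j) y) \<bullet> grad (hat \<T> N x k) y = Q T"
      using A[OF T(1)] AE_space[of "lebesgue_on (interior T)"]
      by eventually_elim (simp add: Q_def grad_hat[OF assms(1) TT] grad_hat[OF assms(2) TT])
    then show "AE y in lebesgue_on P.
      (\<sigma> y *v grad (hat \<T> N x j) y) \<bullet> grad (hat \<T> N x k) y = Q (?i P)"
      unfolding T(2) inv[OF T(1)] .
  qed (rule assms(4))
  also have "\<dots> = (\<Sum>T\<in>\<P>. area T * Q T)"
    using inv by (simp add: sum.reindex[OF inj] area_def)
  finally show ?thesis by (simp add: Q_def)
qed

end

section \<open>Orientation of the triangles at an edge\<close>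

lemma ccw_side_iff:
  assumes "vertices T = {p, q, r}" "cross2 (q - p) (r - p) \<noteq> 0"
  shows "ccw_side T p q \<longleftrightarrow> cross2 (q - p) (r - p) > 0"
proof
  assume "ccw_side T p q"
  then obtain r' where r': "vertices T = {p, q, r'}" "cross2 (q - p) (r' - p) > 0"
    unfolding ccw_side_def det_vector_cross2 by blast
  have "r \<noteq> p" "r \<noteq> q" using assms(2) by auto
  then have "r' = r" using assms(1) r'(1) by auto
  then show "cross2 (q - p) (r - p) > 0" using r'(2) by simp
qed (use assms in \<open>auto simp: ccw_side_def det_vector_cross2\<close>)

lemma ccw_side_commute:
  assumes "2 simplex T" "p \<in> vertices T" "q \<in> vertices T" "p \<noteq> q"
  shows "ccw_side T q p \<longleftrightarrow> \<not> ccw_side T p q"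
proof -
  obtain r where r: "vertices T = {p, q, r}" "cross2 (q - p) (r - p) \<noteq> 0"
    using triangle_obtain[OF assms] .
  then have "ccw_side T p q \<longleftrightarrow> cross2 (q - p) (r - p) > 0" by (rule ccw_side_iff)
  moreover have "ccw_side T q p \<longleftrightarrow> cross2 (p - q) (r - q) > 0"
    using r cross2_swap[of p q r] by (intro ccw_side_iff) auto
  ultimately show ?thesis using r(2) cross2_swap[of p q r] by auto
qed

lemma cross2_combination: "cross2 u (a *\<^sub>R u + b *\<^sub>R v) = b * cross2 u v"
  by (simp add: cross2_def algebra_simps)

text \<open>Start at the midpoint of the common side and move a little in the direction
  \<open>r - p\<close>. The point reached lies in the first triangle and off the line through
  \<open>p\<close> and \<open>q\<close>; for a small step it also lies in the second, as
  \<open>r\<close> and \<open>r'\<close> are on the same side of that line.\<close>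

lemma triangles_same_side_overlap:
  assumes D: "cross2 (q - p) (r - p) > 0" and D': "cross2 (q - p) (r' - p) > 0"
  obtains y where "y \<in> convex hull {p, q, r}" "y \<in> convex hull {p, q, r'}" "cross2 (q - p) (y - p) > 0"
proof -
  let ?D = "cross2 (q - p) (r - p)" and ?D' = "cross2 (q - p) (r' - p)"
  \<comment> \<open>The coordinates of \<open>r - p\<close> in the basis \<open>q - p\<close>,
    \<open>r' - p\<close> are \<open>\<alpha>\<close> and \<open>\<beta>\<close>, by Cramer's rule;
    the common side makes \<open>\<beta>\<close> positive.\<close>
  define \<beta> where "\<beta> = ?D / ?D'"
  define \<alpha> where "\<alpha> = cross2 (r - p) (r' - p) / ?D'"
  have \<beta>: "\<beta> > 0" using D D' by (simp add: \<beta>_def)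
  have "?D' *\<^sub>R (r - p) = cross2 (r - p) (r' - p) *\<^sub>R (q - p) + ?D *\<^sub>R (r' - p)"
    by (simp add: plane_eq_iff cross2_def algebra_simps)
  then have "(1 / ?D') *\<^sub>R (?D' *\<^sub>R (r - p)) = (1 / ?D') *\<^sub>R (cross2 (r - p) (r' - p) *\<^sub>R (q - p) + ?D *\<^sub>R (r' - p))"
    by simp
  then have rr: "r - p = \<alpha> *\<^sub>R (q - p) + \<beta> *\<^sub>R (r' - p)"
    using D' by (simp add: \<alpha>_def \<beta>_def scaleR_add_right)
  \<comment> \<open>So small that \<open>t\<close>, \<open>t * \<bar>\<alpha>\<bar>\<close> and
    \<open>t * \<beta>\<close> add up to 1/2: then in both triangles the coordinates of
    \<open>y\<close> are nonnegative with sum at most 1.\<close>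
  define t where "t = 1 / (2 * (1 + \<bar>\<alpha>\<bar> + \<beta>))"
  have pos: "1 + \<bar>\<alpha>\<bar> + \<beta> > 0" using \<beta> by simp
  then have t: "t > 0" "t * (1 + \<bar>\<alpha>\<bar> + \<beta>) = 1 / 2" by (simp_all add: t_def field_simps)
  then have t2: "t + t * \<bar>\<alpha>\<bar> + t * \<beta> = 1 / 2" by (simp add: algebra_simps)
  have ta: "0 \<le> t * \<bar>\<alpha>\<bar>" "\<bar>t * \<alpha>\<bar> = t * \<bar>\<alpha>\<bar>" "0 < t * \<beta>" using t \<beta> by (simp_all add: abs_mult)
  define y where "y = p + (1/2) *\<^sub>R (q - p) + t *\<^sub>R (r - p)"
  have "y \<in> convex hull {p, q, r}"
    unfolding convex_hull_3_alt y_def using t t2 ta by (intro CollectI exI[of _ "1/2"] exI[of _ t]) auto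
  moreover have "y = p + (1/2 + t * \<alpha>) *\<^sub>R (q - p) + (t * \<beta>) *\<^sub>R (r' - p)"
    unfolding y_def rr by (simp add: algebra_simps)
  then have "y \<in> convex hull {p, q, r'}"
    unfolding convex_hull_3_alt using t t2 ta
    by (intro CollectI exI[of _ "1/2 + t * \<alpha>"] exI[of _ "t * \<beta>"]) (auto simp: abs_le_iff)
  moreover have yp: "y - p = (1/2) *\<^sub>R (q - p) + t *\<^sub>R (r - p)" unfolding y_def by simp
  have "cross2 (q - p) (y - p) = t * ?D" unfolding yp by (rule cross2_combination)
  then have "cross2 (q - p) (y - p) > 0" using t D by simp
  ultimately show ?thesis using that by blast
qed

context labeled_triangulation
begin

text \<open>A common point off the line through \<open>p\<close> and \<open>q\<close> forces the
  common face to have a vertex besides \<open>p\<close> and \<open>q\<close>, which must be the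
  third vertex of both triangles.\<close>

lemma ccw_side_unique:
  assumes T: "T \<in> \<T>" and T': "T' \<in> \<T>" and ccw: "ccw_side T p q" "ccw_side T' p q"
  shows "T = T'"
proof -
  obtain r where r: "vertices T = {p, q, r}" "cross2 (q - p) (r - p) > 0"
    using ccw(1) unfolding ccw_side_def det_vector_cross2 by blast
  obtain r' where r': "vertices T' = {p, q, r'}" "cross2 (q - p) (r' - p) > 0"
    using ccw(2) unfolding ccw_side_def det_vector_cross2 by blast
  obtain y where y: "y \<in> convex hull {p, q, r}" "y \<in> convex hull {p, q, r'}" "cross2 (q - p) (y - p) > 0"
    using triangles_same_side_overlap[OF r(2) r'(2)] .
  have hull: "T = convex hull {p, q, r}" "T' = convex hull {p, q, r'}"
    using triangle_hull(4)[OF simplex[OF T]] triangle_hull(4)[OF simplex[OF T']] r(1) r'(1) by simp_all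
  obtain c where c: "c \<subseteq> vertices T" "c \<subseteq> vertices T'" "T \<inter> T' = convex hull c"
    using Int_eq_hull[OF T T'] .
  have yc: "y \<in> convex hull c" using y hull c(3) by blast
  have "\<not> c \<subseteq> {p, q}"
  proof
    assume "c \<subseteq> {p, q}"
    then have "y \<in> closed_segment p q" using yc hull_mono[of c "{p, q}" convex] by (auto simp: segment_convex_hull)
    then obtain u where "y = (1 - u) *\<^sub>R p + u *\<^sub>R q" by (auto simp: in_segment)
    then have "y - p = u *\<^sub>R (q - p)" by (simp add: algebra_simps)
    then show False using y(3) by (simp add: cross2_def)
  qed
  then have "r = r'" using c r(1) r'(1) by auto
  then show ?thesis using hull by simp
qed

text \<open>A third triangle at the edge would have to be oriented oppositely to two triangles that
  are opposite to each other. The two cases are the boundary and the interior edges.\<close>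

lemma triangles_at_cases:
  assumes T: "T \<in> \<T>" and pq: "p \<in> vertices T" "q \<in> vertices T" "p \<noteq> q"
  obtains "triangles_at \<T> {p, q} = {T}"
  | T' where "T' \<in> \<T>" "T' \<noteq> T" "{p, q} \<subseteq> vertices T'" "triangles_at \<T> {p, q} = {T, T'}"
      "ccw_side T' p q \<longleftrightarrow> \<not> ccw_side T p q"
proof (cases "triangles_at \<T> {p, q} = {T}")
  case False
  have "T \<in> triangles_at \<T> {p, q}" using T pq by (simp add: triangles_at_def)
  with False obtain T' where "T' \<in> triangles_at \<T> {p, q}" "T' \<noteq> T" by auto
  then have T': "T' \<in> \<T>" "{p, q} \<subseteq> vertices T'" "T' \<noteq> T" by (auto simp: triangles_at_def)
  have opp: "ccw_side S' p q \<longleftrightarrow> \<not> ccw_side S p q"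
    if "S \<in> \<T>" "S' \<in> \<T>" "{p, q} \<subseteq> vertices S" "{p, q} \<subseteq> vertices S'" "S \<noteq> S'" for S S'
    using ccw_side_unique[OF that(1,2)] ccw_side_commute[OF simplex[OF that(1)]]
      ccw_side_commute[OF simplex[OF that(2)]] that pq(3) by (metis insert_subset)
  have "S = T \<or> S = T'" if "S \<in> \<T>" "{p, q} \<subseteq> vertices S" for S
    using opp[of S T] opp[of S T'] opp[of T T'] that T T' pq by auto
  then have "triangles_at \<T> {p, q} = {T, T'}" using T T' pq by (auto simp: triangles_at_def)
  then show ?thesis using that(2)[OF T'(1,3,2)] opp[of T T'] T T' pq by auto
qed (use that in blast)

lemma in_edges: "T \<in> \<T> \<Longrightarrow> p \<in> vertices T \<Longrightarrow> q \<in> vertices T \<Longrightarrow> p \<noteq> q \<Longrightarrow> {p, q} \<in> edges \<T>"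
  unfolding edges_def by blast

section \<open>Shifting the off-diagonal entries\<close>

definition label :: "plane \<Rightarrow> nat" where
  "label = the_inv_into {..<N} x"

lemma label_x: "j < N \<Longrightarrow> label (x j) = j"
  using labels by (simp add: label_def bij_betw_def the_inv_into_f_f)

text \<open>The changes required by conditions (ii) and (iii) in one formula. Comparing the
  orientation with the order of the labels makes the sign independent of the order in which the two
  end points are given.\<close>

definition shift :: "(plane set \<Rightarrow> real) \<Rightarrow> plane set \<Rightarrow> plane \<Rightarrow> plane \<Rightarrow> real" where
  "shift \<beta> T u v = (if {u, v} \<in> interior_edges \<T>
     then (if ccw_side T u v \<longleftrightarrow> label u < label v then \<beta> {u, v} else - \<beta> {u, v}) else 0)"

lemma label_eq_iff:
  assumes "T \<in> \<T>" "u \<in> vertices T" "T' \<in> \<T>" "v \<in> vertices T'"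
  shows "label u = label v \<longleftrightarrow> u = v"
  using label_ex[OF assms(1,2)] label_ex[OF assms(3,4)] label_x by metis

lemma shift_commute:
  assumes "T \<in> \<T>" "u \<in> vertices T" "v \<in> vertices T" "u \<noteq> v"
  shows "shift \<beta> T u v = shift \<beta> T v u"
proof -
  have "label v < label u \<longleftrightarrow> \<not> label u < label v"
    using label_eq_iff[OF assms(1,2,1,3)] assms(4) by linarith
  then show ?thesis
    using ccw_side_commute[OF simplex[OF assms(1)] assms(2-4)] by (auto simp: shift_def insert_commute)
qed

text \<open>The two triangles at an interior edge traverse it in opposite directions, so the shifts
  have opposite signs.\<close>

lemma sum_shift:
  assumes "u \<noteq> v"
  shows "(\<Sum>T\<in>triangles_at \<T> {u, v}. shift \<beta> T u v) = 0"
proof (cases "triangles_at \<T> {u, v} = {}")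
  case False
  then obtain T where T: "T \<in> \<T>" "u \<in> vertices T" "v \<in> vertices T" by (auto simp: triangles_at_def)
  show ?thesis
    using T assms
  proof (cases rule: triangles_at_cases)
    case 1
    then show ?thesis by (simp add: shift_def interior_edges_def)
  next
    case (2 T')
    have "shift \<beta> T u v + shift \<beta> T' u v = 0" using 2(5) by (auto simp: shift_def)
    then show ?thesis using 2(2,4) by simp
  qed
qed simp

text \<open>An entry of the element stiffness matrix of \<open>T\<close>, indexed by points instead
  of labels.\<close>

definition stiffness :: "plane set \<Rightarrow> real^2^2 \<Rightarrow> plane \<Rightarrow> plane \<Rightarrow> real" where
  "stiffness T A u v = area T * ((A *v bary_grad T u) \<bullet> bary_grad T v)"

lemma stiffness_commute: "transpose A = A \<Longrightarrow> stiffness T A u v = stiffness T A v u"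
  by (simp add: stiffness_def symmetric_matrix_inner)

lemma stiffness_0:
  assumes "T \<in> \<T>" "\<not> {u, v} \<subseteq> vertices T"
  shows "stiffness T A u v = 0"
  using assms bary_grad_0[OF simplex[OF assms(1)]] by (auto simp: stiffness_def)

lemma sum_over_labels:
  assumes T: "T \<in> \<T>" and f: "\<And>p. p \<notin> vertices T \<Longrightarrow> f p = (0::'a::comm_monoid_add)"
  shows "(\<Sum>k<N. f (x k)) = (\<Sum>p\<in>vertices T. f p)"
proof -
  have "(\<Sum>k<N. f (x k)) = (\<Sum>p\<in>(\<Union>T\<in>\<T>. vertices T). f p)"
    using labels by (rule sum.reindex_bij_betw)
  also have "\<dots> = (\<Sum>p\<in>vertices T. f p)"
    using T f finite_triangles triangle_hull(1)[OF simplex] by (intro sum.mono_neutral_right) auto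
  finally show ?thesis .
qed

text \<open>Row sums vanish because constants have gradient 0.\<close>

lemma sum_stiffness:
  assumes T: "T \<in> \<T>"
  shows "(\<Sum>k<N. stiffness T A u (x k)) = 0"
proof -
  have "(\<Sum>k<N. stiffness T A u (x k)) = (\<Sum>p\<in>vertices T. stiffness T A u p)"
    using stiffness_0[OF T] by (intro sum_over_labels[OF T]) auto
  also have "\<dots> = area T * ((A *v bary_grad T u) \<bullet> (\<Sum>p\<in>vertices T. bary_grad T p))"
    by (simp add: stiffness_def inner_sum_right sum_distrib_left)
  finally show ?thesis by (simp add: sum_bary_grad[OF simplex[OF T]])
qed

text \<open>Replaces the almost everywhere data by one matrix per triangle; from here on a
  conductivity is handled through the finite family \<open>A\<close>.\<close>

definition tensors :: "(plane \<Rightarrow> real^2^2) \<Rightarrow> (plane set \<Rightarrow> real^2^2) \<Rightarrow> bool" where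
  "tensors \<sigma> A \<longleftrightarrow> (\<forall>T\<in>\<T>. transpose (A T) = A T \<and> (AE y in lebesgue_on (interior T). \<sigma> y = A T))"

lemma energy_triangle:
  assumes "tensors \<sigma> A" "T \<in> \<T>" "j < N" "k < N"
  shows "energy \<T> N x T \<sigma> j k = stiffness T (A T) (x j) (x k)"
proof -
  have "T \<in> sets lebesgue" using compact_triangle[OF simplex[OF assms(2)]] by (simp add: lmeasurable_compact fmeasurableD)
  then show ?thesis
    using energy_general[of j k "{T}" T \<sigma> A] assms by (simp add: tensors_def stiffness_def)
qed

text \<open>Condition (ii) speaks of edges ordered by label; symmetry of both sides extends the
  formula to all pairs of distinct vertices. Together with \<open>edge_shiftI\<close> this turns
  \<open>edge_shift\<close> into a prescription of the off-diagonal entries of each element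
  matrix.\<close>

lemma edge_shift_stiffness:
  assumes es: "edge_shift \<T> N x \<beta> \<sigma> \<sigma>'" and A: "tensors \<sigma> A" "tensors \<sigma>' A'"
    and T: "T \<in> \<T>" and uv: "u \<in> vertices T" "v \<in> vertices T" "u \<noteq> v"
  shows "stiffness T (A' T) u v = stiffness T (A T) u v + shift \<beta> T u v"
proof -
  have ordered: "stiffness T (A' T) (x j) (x k) = stiffness T (A T) (x j) (x k) + shift \<beta> T (x j) (x k)"
    if jk: "j < k" "k < N" "x j \<in> vertices T" "x k \<in> vertices T" for j k
  proof -
    let ?e = "{x j, x k}"
    have ne: "x j \<noteq> x k" and jN: "j < N" using jk label_inj[of j k] by auto
    have lab: "label (x j) < label (x k)" using jk jN by (simp add: label_x)
    note en = energy_triangle[OF A(1) T jN jk(2)] energy_triangle[OF A(2) T jN jk(2)]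
    have e: "?e \<in> edges \<T>" using in_edges[OF T jk(3,4) ne] .
    show ?thesis
      using T jk(3,4) ne
    proof (cases rule: triangles_at_cases)
      case 1
      then have "?e \<in> boundary_edges \<T>" "?e \<notin> interior_edges \<T>"
        using e by (auto simp: boundary_edges_def interior_edges_def)
      then have "energy \<T> N x T \<sigma>' j k = energy \<T> N x T \<sigma> j k"
        using es 1 jN jk(2) unfolding edge_shift_def by blast
      then show ?thesis using en \<open>?e \<notin> interior_edges \<T>\<close> by (simp add: shift_def)
    next
      case (2 T')
      then have ie: "?e \<in> interior_edges \<T>" using e by (simp add: interior_edges_def)
      have comm: "ccw_side T (x k) (x j) \<longleftrightarrow> \<not> ccw_side T (x j) (x k)"
        "ccw_side T' (x k) (x j) \<longleftrightarrow> \<not> ccw_side T' (x j) (x k)"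
        using ccw_side_commute[OF simplex[OF T] jk(3,4) ne] ccw_side_commute[OF simplex[OF 2(1)] _ _ ne] 2(3)
        by auto
      show ?thesis
      proof (cases "ccw_side T (x j) (x k)")
        case True
        then have "energy \<T> N x T \<sigma>' j k = energy \<T> N x T \<sigma> j k + \<beta> ?e"
          using es 2(4,5) comm ie jk(1,2) unfolding edge_shift_def by blast
        then show ?thesis using en True ie lab by (simp add: shift_def)
      next
        case False
        \<comment> \<open>Here \<open>T'\<close> runs along the edge in the positive direction, so
          the two triangles exchange roles in condition (ii).\<close>
        moreover have "triangles_at \<T> ?e = {T', T}" using 2(4) by blast
        ultimately have "energy \<T> N x T \<sigma>' j k = energy \<T> N x T \<sigma> j k - \<beta> ?e"
          using es 2(5) comm ie jk(1,2) unfolding edge_shift_def by blast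
        then show ?thesis using en False ie lab by (simp add: shift_def)
      qed
    qed
  qed
  obtain j where j: "j < N" "u = x j" using label_ex[OF T uv(1)] .
  obtain k where k: "k < N" "v = x k" using label_ex[OF T uv(2)] .
  have sym: "transpose (A T) = A T" "transpose (A' T) = A' T" using A T by (simp_all add: tensors_def)
  show ?thesis
  proof (cases "j < k")
    case True
    then show ?thesis using ordered[of j k] j k uv by simp
  next
    case False
    then have "k < j" using uv(3) j k by (cases "j = k") auto
    then show ?thesis
      using ordered[of k j] j k uv stiffness_commute[OF sym(1)] stiffness_commute[OF sym(2)]
        shift_commute[OF T uv] by metis
  qed
qed

lemma edge_shiftI:
  assumes A: "tensors \<sigma> A" "tensors \<sigma>' A'"
    and st: "\<And>T u v. T \<in> \<T> \<Longrightarrow> u \<in> vertices T \<Longrightarrow> v \<in> vertices T \<Longrightarrow> u \<noteq> v \<Longrightarrow>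
      stiffness T (A' T) u v = stiffness T (A T) u v + shift \<beta> T u v"
  shows "edge_shift \<T> N x \<beta> \<sigma> \<sigma>'"
proof -
  have en: "energy \<T> N x T \<sigma>' j k = energy \<T> N x T \<sigma> j k + shift \<beta> T (x j) (x k)"
    if "T \<in> triangles_at \<T> {x j, x k}" "j < N" "k < N" "x j \<noteq> x k" for T j k
    using that st[of T "x j" "x k"] energy_triangle[OF A(1)] energy_triangle[OF A(2)]
    by (simp add: triangles_at_def)
  show ?thesis
    unfolding edge_shift_def
  proof (intro conjI ballI allI impI; (elim conjE)?)
    show "\<exists>A. AE y in lebesgue_on (interior T). \<sigma>' y = A" if "T \<in> \<T>" for T
      using A(2) that unfolding tensors_def by blast
  next
    fix j k T T'
    assume *: "j < k" "k < N" "{x j, x k} \<in> interior_edges \<T>" "triangles_at \<T> {x j, x k} = {T, T'}"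
      "ccw_side T (x j) (x k)" "ccw_side T' (x k) (x j)"
    have ne: "x j \<noteq> x k" and jN: "j < N" using *(1,2) label_inj[of j k] by auto
    have lab: "label (x j) < label (x k)" using * jN by (simp add: label_x)
    have TT: "T \<in> triangles_at \<T> {x j, x k}" "T' \<in> triangles_at \<T> {x j, x k}" using *(4) by auto
    show "energy \<T> N x T \<sigma>' j k = energy \<T> N x T \<sigma> j k + \<beta> {x j, x k}"
      using en[OF TT(1) jN *(2) ne] *(3,5) lab by (simp add: shift_def)
    have "\<not> ccw_side T' (x j) (x k)"
      using TT(2) *(6) ccw_side_commute[OF simplex, of T' "x j" "x k"] ne by (auto simp: triangles_at_def)
    then show "energy \<T> N x T' \<sigma>' j k = energy \<T> N x T' \<sigma> j k - \<beta> {x j, x k}"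
      using en[OF TT(2) jN *(2) ne] *(3) lab by (simp add: shift_def)
  next
    fix j k T
    assume *: "j < N" "k < N" "{x j, x k} \<in> boundary_edges \<T>" "triangles_at \<T> {x j, x k} = {T}"
    then have "x j \<noteq> x k" by (auto simp: boundary_edges_def edges_def doubleton_eq_iff)
    moreover have "{x j, x k} \<notin> interior_edges \<T>" using *(4) by (simp add: interior_edges_def)
    ultimately show "energy \<T> N x T \<sigma>' j k = energy \<T> N x T \<sigma> j k"
      using en[of T j k] * by (simp add: shift_def)
  qed
qed

lemma shifted_tensor_ex:
  assumes sym: "\<And>T. T \<in> \<T> \<Longrightarrow> transpose (A T) = A T"
  obtains A' where "\<And>T. T \<in> \<T> \<Longrightarrow> transpose (A' T) = A' T"
    "\<And>T u v. T \<in> \<T> \<Longrightarrow> u \<in> vertices T \<Longrightarrow> v \<in> vertices T \<Longrightarrow> u \<noteq> v \<Longrightarrow>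
      stiffness T (A' T) u v = stiffness T (A T) u v + shift \<beta> T u v"
proof -
  have "\<exists>M. transpose M = M \<and> (\<forall>u\<in>vertices T. \<forall>v\<in>vertices T. u \<noteq> v \<longrightarrow>
      stiffness T M u v = stiffness T (A T) u v + shift \<beta> T u v)" if T: "T \<in> \<T>" for T
  proof -
    \<comment> \<open>Extended by 0 off the pairs of distinct vertices so that it is symmetric in
      all arguments, as \<open>symmetric_matrix_bary_ex\<close> asks. Dividing by the area turns
      stiffness entries into values of the matrix.\<close>
    define c where "c u v = (if u \<in> vertices T \<and> v \<in> vertices T \<and> u \<noteq> v
      then (stiffness T (A T) u v + shift \<beta> T u v) / area T else 0)" for u v
    have "c u v = c v u" for u v
      using stiffness_commute[OF sym[OF T], of T u v] shift_commute[OF T, of u v] by (auto simp: c_def)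
    then obtain M where M: "transpose M = M" "\<And>u v. u \<in> vertices T \<Longrightarrow> v \<in> vertices T \<Longrightarrow> u \<noteq> v \<Longrightarrow>
      (M *v bary_grad T u) \<bullet> bary_grad T v = c u v"
      using symmetric_matrix_bary_ex[OF simplex[OF T]] by metis
    have "stiffness T M u v = stiffness T (A T) u v + shift \<beta> T u v"
      if "u \<in> vertices T" "v \<in> vertices T" "u \<noteq> v" for u v
      using M(2)[OF that] that area_pos[OF T] by (simp add: stiffness_def[of T M] c_def)
    with M(1) show ?thesis by blast
  qed
  then show ?thesis using that by metis
qed

lemma stiffness_inj:
  assumes T: "T \<in> \<T>" and sym: "transpose A = A" "transpose A' = A'"
    and eq: "\<And>u v. u \<in> vertices T \<Longrightarrow> v \<in> vertices T \<Longrightarrow> u \<noteq> v \<Longrightarrow> stiffness T A u v = stiffness T A' u v"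
  shows "A = A'"
  using eq area_pos[OF T]
  by (intro symmetric_matrix_bary_eq[OF simplex[OF T] sym]) (simp add: stiffness_def)

section \<open>Cancellation of the shifts in the global stiffness matrix\<close>

lemma total_stiffness_eq:
  assumes st: "\<And>T u v. T \<in> \<T> \<Longrightarrow> u \<in> vertices T \<Longrightarrow> v \<in> vertices T \<Longrightarrow> u \<noteq> v \<Longrightarrow>
      stiffness T (A' T) u v = stiffness T (A T) u v + shift \<beta> T u v"
    and jk: "j < N" "k < N"
  shows "(\<Sum>T\<in>\<T>. stiffness T (A' T) (x j) (x k)) = (\<Sum>T\<in>\<T>. stiffness T (A T) (x j) (x k))"
proof -
  have off: "(\<Sum>T\<in>\<T>. stiffness T (A' T) u v) = (\<Sum>T\<in>\<T>. stiffness T (A T) u v)" if "u \<noteq> v" for u v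
  proof -
    \<comment> \<open>Triangles that miss \<open>u\<close> or \<open>v\<close> contribute nothing,
      so the sum shrinks to the triangles at the edge, over which the shifts cancel.\<close>
    have "(\<Sum>T\<in>\<T>. stiffness T (A' T) u v - stiffness T (A T) u v)
        = (\<Sum>T\<in>triangles_at \<T> {u, v}. stiffness T (A' T) u v - stiffness T (A T) u v)"
      using finite_triangles stiffness_0 by (intro sum.mono_neutral_right) (auto simp: triangles_at_def)
    also have "\<dots> = (\<Sum>T\<in>triangles_at \<T> {u, v}. shift \<beta> T u v)"
      using st[of _ u v] that by (intro sum.cong) (auto simp: triangles_at_def)
    also have "\<dots> = 0" using that by (rule sum_shift)
    finally show ?thesis by (simp add: sum_subtractf)
  qed
  \<comment> \<open>Zero row sums on every triangle add up to zero row sums of the global matrix, so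
    a diagonal entry is minus the sum of the others in its row.\<close>
  have diag: "(\<Sum>T\<in>\<T>. stiffness T (C T) (x j) (x j)) = - (\<Sum>k\<in>{..<N} - {j}. \<Sum>T\<in>\<T>. stiffness T (C T) (x j) (x k))"
    for C
  proof -
    have "0 = (\<Sum>T\<in>\<T>. \<Sum>k<N. stiffness T (C T) (x j) (x k))"
      using sum_stiffness by simp
    also have "\<dots> = (\<Sum>k<N. \<Sum>T\<in>\<T>. stiffness T (C T) (x j) (x k))" by (rule sum.swap)
    also have "\<dots> = (\<Sum>T\<in>\<T>. stiffness T (C T) (x j) (x j))
        + (\<Sum>k\<in>{..<N} - {j}. \<Sum>T\<in>\<T>. stiffness T (C T) (x j) (x k))"
      using jk by (intro sum.remove) auto
    finally show ?thesis by simp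
  qed
  show ?thesis
  proof (cases "j = k")
    case True
    have "x j \<noteq> x i" if "i \<in> {..<N} - {j}" for i using that label_inj[OF jk(1), of i] by auto
    then have "(\<Sum>k\<in>{..<N} - {j}. \<Sum>T\<in>\<T>. stiffness T (A' T) (x j) (x k))
        = (\<Sum>k\<in>{..<N} - {j}. \<Sum>T\<in>\<T>. stiffness T (A T) (x j) (x k))"
      by (intro sum.cong refl off)
    then show ?thesis unfolding True[symmetric] diag by simp
  next
    case False
    then show ?thesis using off label_inj[OF jk] by simp
  qed
qed

end

section \<open>The finite element matrix\<close>

lemma invertible_mat_if_inj:
  fixes A :: "'a::field mat"
  assumes A: "A \<in> carrier_mat n n"
    and inj: "\<And>u. u \<in> carrier_vec n \<Longrightarrow> A *\<^sub>v u = 0\<^sub>v n \<Longrightarrow> u = 0\<^sub>v n"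
  shows "invertible_mat A"
proof -
  have "Determinant.det A \<noteq> 0" using det_0_iff_vec_prod_zero_field[OF A] inj by blast
  then have "A \<in> Units (ring_mat TYPE('a) n ())" using A by (rule det_non_zero_imp_unit[rotated])
  then obtain C where "C \<in> carrier_mat n n" "C * A = 1\<^sub>m n" "A * C = 1\<^sub>m n"
    by (auto simp: Units_def ring_mat_simps)
  then show ?thesis using A unfolding invertible_mat_def inverts_mat_def square_mat.simps by auto
qed

locale triangulated_domain = labeled_triangulation \<T> N x
  for \<T> :: "plane set set" and N :: nat and x :: "nat \<Rightarrow> plane" +
  fixes \<Omega> :: "plane set" and B :: nat
  assumes open_domain: "open \<Omega>"
    and negligible_boundary: "negligible (frontier \<Omega>)"
    and triangles_cover: "\<Union>\<T> = closure \<Omega>"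
    and boundary_le: "B \<le> N"
    and boundary_labels: "x ` {..<B} = (\<Union>T\<in>\<T>. vertices T) \<inter> frontier \<Omega>"
begin

lemma frontier_eq: "frontier \<Omega> = closure \<Omega> - \<Omega>"
  using open_domain by (simp add: frontier_def interior_open)

lemma domain_sets: "\<Omega> \<in> sets lebesgue"
  using open_domain by (auto intro: sets_completionI_sets)

lemma PC_tensors:
  assumes "\<sigma> \<in> PC \<Omega> \<T>" shows "\<exists>A. tensors \<sigma> A"
proof -
  have "\<forall>T\<in>\<T>. \<exists>A. transpose A = A \<and> (AE y in lebesgue_on (interior T). \<sigma> y = A)"
    using assms by (simp add: PC_def)
  then show ?thesis unfolding tensors_def by (rule bchoice)
qed

lemma energy_domain:
  assumes "tensors \<sigma> A" "j < N" "k < N"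
  shows "energy \<T> N x \<Omega> \<sigma> j k = (\<Sum>T\<in>\<T>. stiffness T (A T) (x j) (x k))"
proof -
  have "\<Omega> - \<Union>\<T> = {}" "\<Union>\<T> - \<Omega> = frontier \<Omega>"
    using closure_subset triangles_cover frontier_eq by auto
  then show ?thesis
    using energy_general[of j k \<T> \<Omega> \<sigma> A] assms domain_sets negligible_boundary
    by (simp add: tensors_def stiffness_def)
qed

text \<open>The sides of the triangles form a null set, so finitely many statements on the interiors
  combine to one on \<open>\<Omega>\<close>.\<close>

lemma AE_domain:
  assumes "\<And>T. T \<in> \<T> \<Longrightarrow> AE y in lebesgue_on (interior T). P y"
  shows "AE y in lebesgue_on \<Omega>. P y"
proof -
  have "\<forall>T\<in>\<T>. AE y in lebesgue. y \<in> interior T \<longrightarrow> P y"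
  proof
    fix T assume "T \<in> \<T>"
    then show "AE y in lebesgue. y \<in> interior T \<longrightarrow> P y"
      using assms by (simp add: AE_restrict_space_iff)
  qed
  then have 1: "AE y in lebesgue. \<forall>T\<in>\<T>. y \<in> interior T \<longrightarrow> P y"
    unfolding AE_ball_countable[OF countable_finite[OF finite_triangles]] .
  have "negligible (\<Union>T\<in>\<T>. frontier T)"
    using finite_triangles convex_triangle[OF simplex] by (auto intro!: negligible_Union negligible_convex_frontier)
  then have 2: "AE y in lebesgue. y \<notin> (\<Union>T\<in>\<T>. frontier T)" by (rule AE_lebesgue_not_in)
  have "AE y in lebesgue. y \<in> \<Omega> \<longrightarrow> P y"
    using 1 2
  proof eventually_elim
    case (elim y)
    show ?case
    proof
      assume "y \<in> \<Omega>"
      then obtain T where T: "T \<in> \<T>" "y \<in> T" using triangles_cover closure_subset by blast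
      then have "y \<in> interior T" using elim(2) closure_subset[of T] by (auto simp: frontier_def)
      then show "P y" using elim(1) T by blast
    qed
  qed
  then show ?thesis using domain_sets by (simp add: AE_restrict_space_iff)
qed

lemma piecewise_constant_in_PC:
  assumes sym: "\<And>T. T \<in> \<T> \<Longrightarrow> transpose (A T) = A T"
  obtains \<sigma> where "\<sigma> \<in> PC \<Omega> \<T>" "tensors \<sigma> A"
proof -
  \<comment> \<open>This representative vanishes off the interiors of the triangles, so no choice
    has to be made on common sides.\<close>
  define \<sigma> where "\<sigma> y = (\<Sum>T\<in>\<T>. indicator (interior T) y *\<^sub>R A T)" for y
  have val: "\<sigma> y = A T" if T: "T \<in> \<T>" "y \<in> interior T" for T y
  proof -
    have "indicator (interior T') y *\<^sub>R A T' = 0" if "T' \<in> \<T> - {T}" for T'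
      using that interior_disjoint[of T T'] T by (auto simp: indicator_def)
    then show ?thesis
      unfolding \<sigma>_def sum.remove[OF finite_triangles T(1)] using T by (simp add: sum.neutral)
  qed
  have AE: "AE y in lebesgue_on (interior T). \<sigma> y = A T" if "T \<in> \<T>" for T
    using AE_space by eventually_elim (simp add: val that)
  have ten: "tensors \<sigma> A" using AE sym by (simp add: tensors_def)
  have "\<sigma> \<in> borel_measurable (lebesgue_on \<Omega>)"
    unfolding \<sigma>_def
    by (intro borel_measurable_sum borel_measurable_scaleR borel_measurable_const
        measurable_restrict_space1 borel_measurable_indicator) auto
  moreover have "norm (\<sigma> y) \<le> (\<Sum>T\<in>\<T>. norm (A T))" for y
    unfolding \<sigma>_def by (intro sum_norm_le) (auto simp: indicator_def)
  ultimately have "\<sigma> \<in> Linfty \<Omega>" by (auto simp: Linfty_def)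
  then have "\<sigma> \<in> PC \<Omega> \<T>" using sym AE by (auto simp: PC_def)
  with ten show ?thesis using that by blast
qed

lemma FEM_matrix_mult:
  assumes "u \<in> carrier_vec N" "j < N"
  shows "vec_index (FEM_matrix \<Omega> \<T> N B x \<sigma> *\<^sub>v u) j =
    (if j < B then vec_index u j else (\<Sum>k<N. energy \<T> N x \<Omega> \<sigma> j k * vec_index u k))"
proof -
  have "vec_index (FEM_matrix \<Omega> \<T> N B x \<sigma> *\<^sub>v u) j = (\<Sum>k<N.
      (if j < B then (if j = k then 1 else 0) else energy \<T> N x \<Omega> \<sigma> j k) * vec_index u k)"
    using assms by (simp add: FEM_matrix_def scalar_prod_def lessThan_atLeast0)
  also have "\<dots> = (if j < B then vec_index u j else (\<Sum>k<N. energy \<T> N x \<Omega> \<sigma> j k * vec_index u k))"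
    using assms(2) by (simp add: if_distrib[of "\<lambda>c. c * _"] sum.delta' cong: if_cong)
  finally show ?thesis .
qed

section \<open>The discrete Dirichlet energy and the kernel of L(\<sigma>)\<close>

definition local_gradient :: "(nat \<Rightarrow> real) \<Rightarrow> plane set \<Rightarrow> plane" where
  "local_gradient u T = (\<Sum>k<N. u k *\<^sub>R bary_grad T (x k))"

text \<open>\<open>local_gradient u T\<close> is the slope on \<open>T\<close> of the finite element
  function with nodal values \<open>u\<close>. If it vanishes, \<open>u\<close> is constant on the
  vertices of \<open>T\<close>.\<close>

lemma local_gradient_inner:
  assumes T: "T \<in> \<T>" and jk: "j < N" "k < N" "x j \<in> vertices T" "x k \<in> vertices T"
  shows "local_gradient u T \<bullet> (x k - x j) = u k - u j"
proof -
  have "local_gradient u T \<bullet> (x k - x j)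
      = (\<Sum>i<N. (if i = k then u i else 0) - (if i = j then u i else 0))"
    unfolding local_gradient_def inner_sum_left
    using bary_grad_inner[OF simplex[OF T] jk(3,4)] label_inj jk(1,2) by (intro sum.cong) auto
  also have "\<dots> = u k - u j" using jk by (simp add: sum_subtractf)
  finally show ?thesis .
qed

text \<open>The quadratic form of the full stiffness matrix, boundary rows included, is the
  Dirichlet energy of the finite element function.\<close>

lemma quadratic_form:
  "(\<Sum>j<N. u j * (\<Sum>k<N. (\<Sum>T\<in>\<T>. stiffness T (A T) (x j) (x k)) * u k))
    = (\<Sum>T\<in>\<T>. area T * ((A T *v local_gradient u T) \<bullet> local_gradient u T))"
proof -
  have form: "(A T *v local_gradient u T) \<bullet> local_gradient u T
      = (\<Sum>j<N. \<Sum>k<N. u j * u k * ((A T *v bary_grad T (x j)) \<bullet> bary_grad T (x k)))" for T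
  proof -
    have "(A T *v local_gradient u T) \<bullet> local_gradient u T
      = (\<Sum>k<N. \<Sum>j<N. u k * (u j * ((A T *v bary_grad T (x j)) \<bullet> bary_grad T (x k))))"
      unfolding local_gradient_def
      by (simp add: linear_sum[OF matrix_vector_mul_linear] matrix_vector_mult_scaleR inner_sum_left
          inner_sum_right sum_distrib_left mult.assoc)
    also have "\<dots> = (\<Sum>j<N. \<Sum>k<N. u k * (u j * ((A T *v bary_grad T (x j)) \<bullet> bary_grad T (x k))))"
      by (rule sum.swap)
    finally show ?thesis by (simp add: mult_ac)
  qed
  have "(\<Sum>T\<in>\<T>. area T * ((A T *v local_gradient u T) \<bullet> local_gradient u T))
      = (\<Sum>T\<in>\<T>. \<Sum>j<N. \<Sum>k<N. u j * (stiffness T (A T) (x j) (x k) * u k))"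
    unfolding form by (simp add: stiffness_def sum_distrib_left mult_ac)
  also have "\<dots> = (\<Sum>j<N. \<Sum>T\<in>\<T>. \<Sum>k<N. u j * (stiffness T (A T) (x j) (x k) * u k))"
    by (rule sum.swap)
  also have "\<dots> = (\<Sum>j<N. \<Sum>k<N. \<Sum>T\<in>\<T>. u j * (stiffness T (A T) (x j) (x k) * u k))"
    by (intro sum.cong refl sum.swap)
  finally show ?thesis by (simp add: sum_distrib_left sum_distrib_right)
qed

lemma locally_constant_0:
  assumes const: "\<And>T j k. T \<in> \<T> \<Longrightarrow> j < N \<Longrightarrow> k < N \<Longrightarrow> x j \<in> vertices T \<Longrightarrow> x k \<in> vertices T \<Longrightarrow> u j = u k"
    and bdry: "\<And>j. j < B \<Longrightarrow> u j = 0" and i: "i < N"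
  shows "u i = (0::real)"
proof -
  define \<K> where "\<K> = {T\<in>\<T>. \<exists>j<N. x j \<in> vertices T \<and> u j \<noteq> 0}"
  define K where "K = \<Union>\<K>"
  define K' where "K' = \<Union>(\<T> - \<K>)"
  have sub: "\<K> \<subseteq> \<T>" by (auto simp: \<K>_def)
  have compact: "compact (\<Union>\<P>)" if "\<P> \<subseteq> \<T>" for \<P>
    using that finite_triangles compact_triangle[OF simplex] finite_subset by (intro compact_Union) blast+
  have cover: "closure \<Omega> = K \<union> K'" using sub unfolding K_def K'_def triangles_cover[symmetric] by blast
  \<comment> \<open>A nonempty common face has a vertex, at which \<open>u\<close> would be nonzero
    seen from \<open>T\<close> and zero seen from \<open>T'\<close>.\<close>
  have "K \<inter> K' = {}"
  proof (rule ccontr)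
    assume "K \<inter> K' \<noteq> {}"
    then obtain T T' where TT: "T \<in> \<K>" "T' \<in> \<T>" "T' \<notin> \<K>" "T \<inter> T' \<noteq> {}"
      by (auto simp: K_def K'_def)
    then have T: "T \<in> \<T>" using sub by blast
    obtain c where c: "c \<subseteq> vertices T" "c \<subseteq> vertices T'" "T \<inter> T' = convex hull c"
      using Int_eq_hull[OF T TT(2)] .
    then obtain v where v: "v \<in> c" using TT(4) by fastforce
    obtain j where j: "j < N" "v = x j" using label_ex[OF T] v c by blast
    obtain k where k: "k < N" "x k \<in> vertices T" "u k \<noteq> 0" using TT(1) by (auto simp: \<K>_def)
    have "u j = u k" using const[OF T j(1) k(1) _ k(2)] v c(1) j(2) by blast
    moreover have "u j = 0" using TT(2,3) v c(2) j by (auto simp: \<K>_def)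
    ultimately show False using k(3) by simp
  qed
  have "\<K> = {}"
  proof (rule ccontr)
    assume "\<K> \<noteq> {}"
    then obtain T where "T \<in> \<K>" by blast
    then obtain j where "x j \<in> vertices T" "T \<in> \<K>" by (auto simp: \<K>_def)
    then have "K \<noteq> {}" using vertex_in_triangle by (auto simp: K_def)
    moreover have "compact K" using compact[OF sub] by (simp add: K_def)
    ultimately obtain p where p: "p extreme_point_of (convex hull K)"
      using extreme_point_exists_convex[of "convex hull K"] compact_convex_hull by auto
    then have pK: "p \<in> K" by (rule extreme_point_of_convex_hull)
    then obtain T where T: "T \<in> \<K>" "p \<in> T" by (auto simp: K_def)
    have "T \<subseteq> convex hull K" using T(1) hull_subset[of K convex] by (auto simp: K_def)
    then have "p extreme_point_of T" using p T(2) unfolding extreme_point_of_def by blast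
    then have pv: "p \<in> vertices T" by (simp add: vertices_def)
    have TT: "T \<in> \<T>" using T sub by blast
    obtain j where j: "j < N" "p = x j" using label_ex[OF TT pv] .
    obtain k where k: "k < N" "x k \<in> vertices T" "u k \<noteq> 0" using T(1) by (auto simp: \<K>_def)
    have uj: "u j \<noteq> 0" using const[OF TT j(1) k(1)] k pv j(2) by auto
    \<comment> \<open>Near a point of \<open>\<Omega>\<close> off the closed set \<open>K'\<close>
      the domain is covered by \<open>K\<close> alone, so \<open>p\<close> would be interior to the
      hull and not extreme.\<close>
    have "p \<notin> \<Omega>"
    proof
      assume "p \<in> \<Omega>"
      then have "p \<in> \<Omega> - K'" using pK \<open>K \<inter> K' = {}\<close> by blast
      moreover have "open (\<Omega> - K')"
        using open_domain compact[of "\<T> - \<K>"] by (simp add: K'_def compact_imp_closed open_Diff)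
      moreover have "\<Omega> - K' \<subseteq> convex hull K"
        using cover closure_subset[of \<Omega>] hull_subset[of K convex] by blast
      ultimately have "p \<in> interior (convex hull K)" using interior_maximal by blast
      then show False using extreme_point_not_in_interior[OF p] by blast
    qed
    then have "p \<in> frontier \<Omega>" using pK cover frontier_eq by blast
    then have "p \<in> x ` {..<B}" using boundary_labels TT pv by blast
    then obtain l where l: "l < B" "p = x l" by blast
    have "l < N" "x l = x j" using l j(2) boundary_le by simp_all
    then have "l = j" using label_inj[OF _ j(1)] by blast
    then show False using uj bdry l(1) by blast
  qed
  obtain T where "T \<in> \<T>" "x i \<in> vertices T" using label_vertex[OF i] .
  then show ?thesis using \<open>\<K> = {}\<close> i by (auto simp: \<K>_def)
qed

lemma FEM_matrix_invertible:
  assumes A: "tensors \<sigma> A" and pd: "\<And>T. T \<in> \<T> \<Longrightarrow> pos_def (A T)"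
  shows "invertible_mat (FEM_matrix \<Omega> \<T> N B x \<sigma>)"
proof (rule invertible_mat_if_inj)
  let ?L = "FEM_matrix \<Omega> \<T> N B x \<sigma>"
  show "?L \<in> carrier_mat N N" by (simp add: FEM_matrix_def)
  fix w assume w: "w \<in> carrier_vec N" and L0: "?L *\<^sub>v w = 0\<^sub>v N"
  let ?u = "vec_index w"
  have row: "(if j < B then ?u j else (\<Sum>k<N. energy \<T> N x \<Omega> \<sigma> j k * ?u k)) = 0" if "j < N" for j
    using FEM_matrix_mult[OF w that, of \<sigma>] L0 that by simp
  have bdry: "?u j = 0" if "j < B" for j using row[of j] that boundary_le by simp
  \<comment> \<open>The boundary rows of the stiffness matrix are not part of \<open>?L\<close>, but
    they are multiplied by \<open>?u j = 0\<close>; the other rows annihilate \<open>w\<close>. So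
    the energy of \<open>w\<close> is 0.\<close>
  have "?u j * (\<Sum>k<N. (\<Sum>T\<in>\<T>. stiffness T (A T) (x j) (x k)) * ?u k) = 0" if "j < N" for j
    using row[OF that] bdry[of j] energy_domain[OF A that] by (cases "j < B") auto
  then have sum0: "(\<Sum>T\<in>\<T>. area T * ((A T *v local_gradient ?u T) \<bullet> local_gradient ?u T)) = 0"
    unfolding quadratic_form[symmetric] by (intro sum.neutral ballI) (simp only: lessThan_iff)
  have nonneg: "0 \<le> area T * ((A T *v local_gradient ?u T) \<bullet> local_gradient ?u T)" if "T \<in> \<T>" for T
    using pd[OF that] area_pos[OF that] unfolding pos_def_def
    by (cases "local_gradient ?u T = 0") (auto simp: inner_commute less_imp_le)
  have zero: "area T * ((A T *v local_gradient ?u T) \<bullet> local_gradient ?u T) = 0" if "T \<in> \<T>" for T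
    using iffD1[OF sum_nonneg_eq_0_iff[OF finite_triangles nonneg] sum0] that by (rule bspec)
  have grad0: "local_gradient ?u T = 0" if "T \<in> \<T>" for T
  proof (rule ccontr)
    assume "local_gradient ?u T \<noteq> 0"
    then have "local_gradient ?u T \<bullet> (A T *v local_gradient ?u T) > 0" using pd[OF that] by (simp add: pos_def_def)
    then show False using zero[OF that] area_pos[OF that] by (simp add: inner_commute)
  qed
  have "?u i = 0" if "i < N" for i
  proof (rule locally_constant_0[OF _ bdry that])
    fix T j k assume *: "T \<in> \<T>" "j < N" "k < N" "x j \<in> vertices T" "x k \<in> vertices T"
    show "?u j = ?u k" using local_gradient_inner[OF *, of ?u] grad0[OF *(1)] by simp
  qed
  then show "w = 0\<^sub>v N" using w by (intro eq_vecI) auto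
qed

end

theorem theorem1p4:
  fixes \<Omega> :: "plane set" and \<T> :: "plane set set" and x :: "nat \<Rightarrow> plane" and N B :: nat
    and \<sigma> :: "plane \<Rightarrow> real^2^2" and \<beta> :: "plane set \<Rightarrow> real"
  assumes "simple_polygon_interior \<Omega>"
    and "triangulation_of \<T> (closure \<Omega>)"
    and "vertex_labeling \<Omega> \<T> N B x"
    and "\<sigma> \<in> PC_plus \<Omega> \<T>"
  shows "(\<exists>\<sigma>'\<in>PC \<Omega> \<T>. edge_shift \<T> N x \<beta> \<sigma> \<sigma>' \<and>
            (\<forall>\<tau>\<in>PC \<Omega> \<T>. edge_shift \<T> N x \<beta> \<sigma> \<tau> \<longrightarrow> (AE y in lebesgue_on \<Omega>. \<tau> y = \<sigma>' y))) \<and>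
         (\<forall>\<sigma>'\<in>PC \<Omega> \<T>. edge_shift \<T> N x \<beta> \<sigma> \<sigma>' \<longrightarrow>
            invertible_mat (FEM_matrix \<Omega> \<T> N B x \<sigma>) \<and>
            invertible_mat (FEM_matrix \<Omega> \<T> N B x \<sigma>') \<and>
            (\<forall>f\<in>carrier_vec B. FEM_DN \<Omega> \<T> N B x \<sigma> f = FEM_DN \<Omega> \<T> N B x \<sigma>' f))"
proof -
  interpret triangulated_domain \<T> N x \<Omega> B
  proof
    note tri = assms(2)[unfolded triangulation_of_def triangulation_def]
    show "finite \<T>" "\<And>T. T \<in> \<T> \<Longrightarrow> 2 simplex T" "\<Union>\<T> = closure \<Omega>"
      "\<And>T T'. T \<in> \<T> \<Longrightarrow> T' \<in> \<T> \<Longrightarrow> (T \<inter> T') face_of T"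
      using tri by blast+
    show "bij_betw x {..<N} (\<Union>T\<in>\<T>. vertices T)" "B \<le> N"
      "x ` {..<B} = (\<Union>T\<in>\<T>. vertices T) \<inter> frontier \<Omega>"
      using assms(3) unfolding vertex_labeling_def by blast+
  qed (rule simple_polygon_interior_props[OF assms(1)])+
  have "\<forall>T\<in>\<T>. \<exists>A. transpose A = A \<and> pos_def A \<and> (AE y in lebesgue_on (interior T). \<sigma> y = A)"
    using assms(4) by (simp add: PC_plus_def)
  then obtain A where A0: "\<forall>T\<in>\<T>. transpose (A T) = A T \<and> pos_def (A T) \<and> (AE y in lebesgue_on (interior T). \<sigma> y = A T)"
    using bchoice by metis
  then have A: "tensors \<sigma> A" and pd: "\<And>T. T \<in> \<T> \<Longrightarrow> pos_def (A T)" and sym: "\<And>T. T \<in> \<T> \<Longrightarrow> transpose (A T) = A T"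
    by (auto simp: tensors_def)
  \<comment> \<open>Existence: the entries are shifted on each triangle separately and the resulting
    matrices are glued together.\<close>
  obtain A' where A': "\<And>T. T \<in> \<T> \<Longrightarrow> transpose (A' T) = A' T"
    "\<And>T u v. T \<in> \<T> \<Longrightarrow> u \<in> vertices T \<Longrightarrow> v \<in> vertices T \<Longrightarrow> u \<noteq> v \<Longrightarrow>
      stiffness T (A' T) u v = stiffness T (A T) u v + shift \<beta> T u v"
    using shifted_tensor_ex[where A = A and \<beta> = \<beta>] sym by metis
  obtain \<sigma>' where \<sigma>': "\<sigma>' \<in> PC \<Omega> \<T>" "tensors \<sigma>' A'" using piecewise_constant_in_PC[OF A'(1)] .
  have shifted: "edge_shift \<T> N x \<beta> \<sigma> \<sigma>'" using edge_shiftI[OF A \<sigma>'(2) A'(2)] .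
  have unique: "AE y in lebesgue_on \<Omega>. \<tau> y = \<sigma>' y"
    if \<tau>: "\<tau> \<in> PC \<Omega> \<T>" "edge_shift \<T> N x \<beta> \<sigma> \<tau>" for \<tau>
  proof -
    obtain C where C: "tensors \<tau> C" using PC_tensors[OF \<tau>(1)] by blast
    \<comment> \<open>The conditions fix all off-diagonal element entries of \<open>\<tau>\<close>,
      and these determine the symmetric matrix.\<close>
    have "C T = A' T" if T: "T \<in> \<T>" for T
    proof (rule stiffness_inj[OF T _ A'(1)[OF T]])
      show "transpose (C T) = C T" using C T by (simp add: tensors_def)
      show "stiffness T (C T) u v = stiffness T (A' T) u v"
        if "u \<in> vertices T" "v \<in> vertices T" "u \<noteq> v" for u v
        unfolding edge_shift_stiffness[OF \<tau>(2) A C T that] A'(2)[OF T that] ..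
    qed
    then have CA: "AE y in lebesgue_on (interior T). \<tau> y = A' T" if "T \<in> \<T>" for T
      using C that by (simp add: tensors_def)
    have "AE y in lebesgue_on (interior T). \<tau> y = \<sigma>' y" if T: "T \<in> \<T>" for T
    proof -
      have "AE y in lebesgue_on (interior T). \<sigma>' y = A' T" using \<sigma>'(2) T by (simp add: tensors_def)
      with CA[OF T] show ?thesis by eventually_elim simp
    qed
    then show ?thesis by (rule AE_domain)
  qed
  have invertible: "invertible_mat (FEM_matrix \<Omega> \<T> N B x \<sigma>)" using FEM_matrix_invertible[OF A pd] .
  \<comment> \<open>Every \<open>\<tau>\<close> that meets the conditions shares its
    \<open>FEM_matrix\<close> with \<open>\<sigma>\<close>, so it inherits invertibility although it
    need not be positive definite.\<close>
  have same: "FEM_matrix \<Omega> \<T> N B x \<sigma> = FEM_matrix \<Omega> \<T> N B x \<tau> \<and>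
      FEM_DN \<Omega> \<T> N B x \<sigma> f = FEM_DN \<Omega> \<T> N B x \<tau> f"
    if \<tau>: "\<tau> \<in> PC \<Omega> \<T>" "edge_shift \<T> N x \<beta> \<sigma> \<tau>" for \<tau> f
  proof -
    obtain C where C: "tensors \<tau> C" using PC_tensors[OF \<tau>(1)] by blast
    have en: "energy \<T> N x \<Omega> \<sigma> j k = energy \<T> N x \<Omega> \<tau> j k" if "j < N" "k < N" for j k
      unfolding energy_domain[OF A that] energy_domain[OF C that]
      by (rule total_stiffness_eq[OF edge_shift_stiffness[OF \<tau>(2) A C] that, symmetric])
    then have L: "FEM_matrix \<Omega> \<T> N B x \<sigma> = FEM_matrix \<Omega> \<T> N B x \<tau>"
      unfolding FEM_matrix_def by (intro cong_mat) auto
    \<comment> \<open>\<open>FEM_matrix\<close> has unit rows for \<open>j < B\<close>, so equality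
      of these energies is not contained in \<open>L\<close>; it is needed for the output of
      \<open>FEM_DN\<close>.\<close>
    have "energy \<T> N x \<Omega> \<sigma> j k = energy \<T> N x \<Omega> \<tau> j k" if "j < B" "k < N" for j k
      using en that boundary_le by simp
    then have "FEM_DN \<Omega> \<T> N B x \<sigma> f = FEM_DN \<Omega> \<T> N B x \<tau> f"
      unfolding FEM_DN_def L Let_def by (intro eq_vecI) (auto intro!: sum.cong)
    with L show ?thesis by blast
  qed
  show ?thesis
  proof (intro conjI ballI impI bexI[of _ \<sigma>'])
    fix \<tau> assume \<tau>: "\<tau> \<in> PC \<Omega> \<T>" "edge_shift \<T> N x \<beta> \<sigma> \<tau>"
    show "AE y in lebesgue_on \<Omega>. \<tau> y = \<sigma>' y" using \<tau> by (rule unique)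
    show "invertible_mat (FEM_matrix \<Omega> \<T> N B x \<sigma>)" by (rule invertible)
    then show "invertible_mat (FEM_matrix \<Omega> \<T> N B x \<tau>)" using same[OF \<tau>] by simp
    show "FEM_DN \<Omega> \<T> N B x \<sigma> f = FEM_DN \<Omega> \<T> N B x \<tau> f" for f using same[OF \<tau>] by blast
  qed (fact shifted \<sigma>'(1))+
qed

end
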